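(* Let $K$ be a field of characteristic $p>0$, $\delta:K\to K$ a derivation, and $F=\{a\in K : \delta(a)=0\}$. Suppose $\delta$ is algebraic over $F$ with minimum polynomial $g(t)=t^p-t\in F[t]$. Let $d\in K$ and $f(t)=t^p-t-d\in K[t;\delta]$. Then $(K,\delta,d)=S_f=K[t;\delta]/K[t;\delta]f(t)$ is a (not necessarily associative) algebra over $F$ of dimension $p^2$, and the following are equivalent: (a) $(K,\delta,d)$ is a division algebra; (b) $V_p(z)-z\neq d$ for all $z\in K$; (c) $z^p+\delta^{p-1}(z)-z\neq d$ for all $z\in K$. Moreover, ${\rm Aut}_F(S_f)$ has a cyclic subgroup of order $p$ generated by $G=G_{id,-1}$; in particular $G|_K=id_K$.
   Context: $K[t;\delta]$ is the differential polynomial ring: polynomials $\sum a_it^i$ with left coefficients $a_i\in K$, termwise addition, and multiplication determined by $ta=at+\delta(a)$ for $a\in K$. It has right division: for all $h,f$ with $f\neq 0$ there are unique $q,r$ with $h=qf+r$ and $\deg r<\deg f$; write $r=h \bmod_r f$. For monic $f\in K[t;\delta]$ of degree $m\ge 2$, the Petit algebra $S_f=K[t;\delta]/K[t;\delta]f$ is the $F$-vector space $\{h\in K[t;\delta] : \deg h<m\}$ with multiplication $h\circ k = hk \bmod_r f$; it is a unital, not necessarily associative $F$-algebra containing $K$ as the constant polynomials. A nonassociative algebra $A\neq0$ is a division algebra if for each $a\neq 0$ left and right multiplication by $a$ are bijective. For $b\in K$, $V_p(b)\in K$ is defined by $(t-b)^p=t^p-V_p(b)$ in $K[t;\delta]$.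 $G_{id,-1}$ denotes the map $\sum a_it^i\mapsto\sum a_i(t-1)^i$ (on $K[t;\delta]$, and the induced map on $S_f$). *)

theory Defs
  imports
    "HOL-Computational_Algebra.Computational_Algebra"
    "HOL-Algebra.Elementary_Groups"
    "HOL-Algebra.Bij"
    "Jordan_Normal_Form.Missing_VectorSpace"
begin

definition derivation :: "('a::field \<Rightarrow> 'a) \<Rightarrow> bool" where
  "derivation \<delta> \<longleftrightarrow>
     (\<forall>a b. \<delta> (a + b) = \<delta> a + \<delta> b) \<and> (\<forall>a b. \<delta> (a * b) = \<delta> a * b + a * \<delta> b)"

definition const_field :: "('a::field \<Rightarrow> 'a) \<Rightarrow> 'a ring" where
  "const_field \<delta> = \<lparr>carrier = {a. \<delta> a = 0}, mult = (*), one = 1, zero = 0, add = (+)\<rparr>"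

definition poly_at_map :: "'a::field poly \<Rightarrow> ('a \<Rightarrow> 'a) \<Rightarrow> 'a \<Rightarrow> 'a" where
  "poly_at_map q \<delta> z = (\<Sum>i\<le>degree q. coeff q i * (\<delta> ^^ i) z)"

text \<open>Minimum polynomial over the constants: the monic polynomial of least degree, among those
  with coefficients in \<open>F = {a. \<delta> a = 0}\<close>, that annihilates \<open>\<delta>\<close>. In particular \<open>\<delta>\<close> is algebraic
  over \<open>F\<close>.\<close>

definition is_min_poly :: "('a::field \<Rightarrow> 'a) \<Rightarrow> 'a poly \<Rightarrow> bool" where
  "is_min_poly \<delta> g \<longleftrightarrow>
     lead_coeff g = 1 \<and> (\<forall>i. coeff g i \<in> carrier (const_field \<delta>)) \<and>
     (\<forall>z. poly_at_map g \<delta> z = 0) \<and>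
     (\<forall>q. q \<noteq> 0 \<longrightarrow> (\<forall>i. coeff q i \<in> carrier (const_field \<delta>)) \<longrightarrow>
        (\<forall>z. poly_at_map q \<delta> z = 0) \<longrightarrow> degree g \<le> degree q)"

text \<open>The type \<open>'a poly\<close> only supplies the coefficient sequences and their addition; the
  multiplication is the skew one. Left multiplication by \<open>t\<close> sends \<open>\<Sum> b\<^sub>j t\<^sup>j\<close> to
  \<open>\<Sum> (b\<^sub>j t + \<delta>(b\<^sub>j)) t\<^sup>j\<close>, which extends to all left factors \<open>\<Sum> a\<^sub>i t\<^sup>i\<close> by iteration.\<close>

definition t_mult :: "('a::field \<Rightarrow> 'a) \<Rightarrow> 'a poly \<Rightarrow> 'a poly" where
  "t_mult \<delta> h = pCons 0 h + map_poly \<delta> h"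

definition skew_mult :: "('a::field \<Rightarrow> 'a) \<Rightarrow> 'a poly \<Rightarrow> 'a poly \<Rightarrow> 'a poly" where
  "skew_mult \<delta> g h = (\<Sum>i\<le>degree g. Polynomial.smult (coeff g i) ((t_mult \<delta> ^^ i) h))"

definition diff_poly_ring :: "('a::field \<Rightarrow> 'a) \<Rightarrow> 'a poly ring" where
  "diff_poly_ring \<delta> =
     \<lparr>carrier = UNIV, mult = skew_mult \<delta>, one = 1, zero = 0, add = (+)\<rparr>"

lemma derivation_0: "derivation \<delta> \<Longrightarrow> \<delta> 0 = 0"
  unfolding derivation_def by (metis add_cancel_right_right)

lemma degree_map_poly_bound: "degree (map_poly \<delta> h) \<le> degree h" if "\<delta> 0 = 0"
  by (rule degree_le) (simp add: coeff_map_poly that coeff_eq_0)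

lemma coeff_t_mult:
  assumes "derivation \<delta>"
  shows "coeff (t_mult \<delta> h) n = (if n = 0 then 0 else coeff h (n - 1)) + \<delta> (coeff h n)"
  using derivation_0[OF assms] by (cases n) (simp_all add: t_mult_def coeff_map_poly)

lemma t_mult_add: "derivation \<delta> \<Longrightarrow> t_mult \<delta> (g + h) = t_mult \<delta> g + t_mult \<delta> h"
  by (rule poly_eqI) (auto simp: coeff_t_mult derivation_def)

lemma t_mult_smult:
  "derivation \<delta> \<Longrightarrow>
     t_mult \<delta> (Polynomial.smult a h) = Polynomial.smult a (t_mult \<delta> h) + Polynomial.smult (\<delta> a) h"
  by (rule poly_eqI) (auto simp: coeff_t_mult derivation_def algebra_simps)

lemma t_mult_0: "derivation \<delta> \<Longrightarrow> t_mult \<delta> 0 = 0"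
  by (rule poly_eqI) (simp add: coeff_t_mult derivation_0)

lemma t_mult_sum: "derivation \<delta> \<Longrightarrow> t_mult \<delta> (\<Sum>i\<in>I. h i) = (\<Sum>i\<in>I. t_mult \<delta> (h i))"
  by (induction I rule: infinite_finite_induct) (simp_all add: t_mult_0 t_mult_add)

lemma t_mult_funpow_add:
  "derivation \<delta> \<Longrightarrow> (t_mult \<delta> ^^ i) (g + h) = (t_mult \<delta> ^^ i) g + (t_mult \<delta> ^^ i) h"
  by (induction i) (simp_all add: t_mult_add)

lemma skew_mult_altdef:
  assumes "degree g \<le> n"
  shows "skew_mult \<delta> g h = (\<Sum>i\<le>n. Polynomial.smult (coeff g i) ((t_mult \<delta> ^^ i) h))"
  unfolding skew_mult_def
  by (rule sum.mono_neutral_left) (use assms in \<open>auto simp: coeff_eq_0\<close>)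

lemma smult_sum_right:
  "Polynomial.smult a (\<Sum>i\<in>I. h i) = (\<Sum>i\<in>I. Polynomial.smult a (h i))"
  by (induction I rule: infinite_finite_induct) (simp_all add: smult_add_right)

lemma skew_mult_add_left:
  "skew_mult \<delta> (g + g') h = skew_mult \<delta> g h + skew_mult \<delta> g' h"
proof -
  define n where "n = max (degree g) (degree g')"
  have "degree g \<le> n" "degree g' \<le> n" "degree (g + g') \<le> n"
    by (auto simp: n_def degree_add_le)
  then show ?thesis
    by (simp add: skew_mult_altdef[of _ n] smult_add_left sum.distrib)
qed

lemma skew_mult_smult_left:
  "skew_mult \<delta> (Polynomial.smult a g) h = Polynomial.smult a (skew_mult \<delta> g h)"
  by (simp add: skew_mult_altdef[of _ "degree g"] degree_smult_le smult_sum_right)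

lemma skew_mult_0_left: "skew_mult \<delta> 0 h = 0"
  by (simp add: skew_mult_def)

lemma skew_mult_sum_left:
  "skew_mult \<delta> (\<Sum>i\<in>I. g i) h = (\<Sum>i\<in>I. skew_mult \<delta> (g i) h)"
  by (induction I rule: infinite_finite_induct) (simp_all add: skew_mult_0_left skew_mult_add_left)

lemma skew_mult_add_right:
  "derivation \<delta> \<Longrightarrow> skew_mult \<delta> g (h + h') = skew_mult \<delta> g h + skew_mult \<delta> g h'"
  by (simp add: skew_mult_def t_mult_funpow_add smult_add_right sum.distrib)

lemma skew_mult_t_mult:
  assumes "derivation \<delta>"
  shows "skew_mult \<delta> (t_mult \<delta> g) h = t_mult \<delta> (skew_mult \<delta> g h)"
proof -
  define n where "n = degree g"
  have dm: "degree (map_poly \<delta> g) \<le> n"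
    unfolding n_def by (rule degree_map_poly_bound) (rule derivation_0[OF assms])
  have "skew_mult \<delta> (pCons 0 g) h = (\<Sum>i\<le>Suc n. Polynomial.smult (coeff (pCons 0 g) i) ((t_mult \<delta> ^^ i) h))"
    by (rule skew_mult_altdef) (simp add: n_def degree_pCons_le)
  also have "\<dots> = (\<Sum>i\<le>n. Polynomial.smult (coeff g i) ((t_mult \<delta> ^^ Suc i) h))"
    by (subst sum.atMost_Suc_shift) simp
  finally show ?thesis
    using dm derivation_0[OF assms]
    by (simp add: t_mult_def[of _ g] skew_mult_add_left skew_mult_altdef[of "map_poly \<delta> g" n]
        skew_mult_altdef[of g n] n_def t_mult_sum[OF assms] t_mult_smult[OF assms] sum.distrib
        coeff_map_poly)
qed

lemma skew_mult_assoc: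
  assumes "derivation \<delta>"
  shows "skew_mult \<delta> (skew_mult \<delta> g h) k = skew_mult \<delta> g (skew_mult \<delta> h k)"
proof -
  have "skew_mult \<delta> ((t_mult \<delta> ^^ i) h) k = (t_mult \<delta> ^^ i) (skew_mult \<delta> h k)" for i
    by (induction i) (simp_all add: skew_mult_t_mult[OF assms])
  then show ?thesis
    by (simp add: skew_mult_def[of _ g] skew_mult_sum_left skew_mult_smult_left)
qed

lemma skew_mult_const_left: "skew_mult \<delta> [:a:] h = Polynomial.smult a h"
  by (simp add: skew_mult_def)

lemma skew_mult_1_left: "skew_mult \<delta> 1 h = h"
  by (simp add: skew_mult_def)

lemma skew_mult_t_left: "skew_mult \<delta> [:0, 1:] h = t_mult \<delta> h"
  by (simp add: skew_mult_def)

lemma skew_mult_t_const: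
  assumes "derivation \<delta>"
  shows "skew_mult \<delta> [:0, 1:] [:a:] = skew_mult \<delta> [:a:] [:0, 1:] + [:\<delta> a:]"
  by (rule poly_eqI)
    (simp add: skew_mult_t_left skew_mult_const_left coeff_t_mult[OF assms] derivation_0[OF assms]
      coeff_pCons split: nat.splits)

lemma derivation_1: "derivation \<delta> \<Longrightarrow> \<delta> 1 = 0"
  unfolding derivation_def by (metis add_cancel_right_right mult.right_neutral mult_1)

lemma t_mult_monom:
  "derivation \<delta> \<Longrightarrow> t_mult \<delta> (Polynomial.monom 1 n) = Polynomial.monom 1 (Suc n)"
  by (rule poly_eqI) (auto simp: coeff_t_mult derivation_0 derivation_1)

lemma t_mult_funpow_1: "derivation \<delta> \<Longrightarrow> (t_mult \<delta> ^^ i) 1 = Polynomial.monom 1 i"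
  by (induction i) (simp_all add: t_mult_monom)

lemma skew_mult_1_right: "derivation \<delta> \<Longrightarrow> skew_mult \<delta> g 1 = g"
  by (simp add: skew_mult_def t_mult_funpow_1 smult_monom poly_as_sum_of_monoms)

lemma ring_diff_poly_ring:
  assumes "derivation \<delta>"
  shows "ring (diff_poly_ring \<delta>)"
proof (rule ringI)
  show "abelian_group (diff_poly_ring \<delta>)"
  proof (rule abelian_groupI)
    fix x show "\<exists>y\<in>carrier (diff_poly_ring \<delta>). y \<oplus>\<^bsub>diff_poly_ring \<delta>\<^esub> x = \<zero>\<^bsub>diff_poly_ring \<delta>\<^esub>"
      by (rule bexI[of _ "- x"]) (simp_all add: diff_poly_ring_def)
  qed (simp_all add: diff_poly_ring_def algebra_simps)
  show "Group.monoid (diff_poly_ring \<delta>)"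
    by (rule monoidI)
      (simp_all add: diff_poly_ring_def skew_mult_assoc[OF assms] skew_mult_1_right[OF assms]
        skew_mult_1_left)
qed (simp_all add: diff_poly_ring_def skew_mult_add_left skew_mult_add_right[OF assms])

lemma degree_t_mult_le: "derivation \<delta> \<Longrightarrow> degree (t_mult \<delta> h) \<le> Suc (degree h)"
  unfolding t_mult_def
  by (intro degree_add_le degree_pCons_le order.trans[OF degree_map_poly_bound]) (auto simp: derivation_0)

lemma degree_t_mult_funpow_le: "derivation \<delta> \<Longrightarrow> degree ((t_mult \<delta> ^^ i) h) \<le> i + degree h"
proof (induction i)
  case (Suc i)
  then show ?case using degree_t_mult_le[of \<delta> "(t_mult \<delta> ^^ i) h"] by simp
qed simp

lemma coeff_t_mult_funpow:
  "derivation \<delta> \<Longrightarrow> coeff ((t_mult \<delta> ^^ i) h) (i + degree h) = lead_coeff h"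
proof (induction i)
  case (Suc i)
  have "coeff ((t_mult \<delta> ^^ i) h) (Suc (i + degree h)) = 0"
    using degree_t_mult_funpow_le[OF Suc.prems, of i h] by (simp add: coeff_eq_0)
  with Suc show ?case by (simp add: coeff_t_mult derivation_0)
qed simp

lemma coeff_skew_mult_degree:
  assumes "derivation \<delta>"
  shows "coeff (skew_mult \<delta> g h) (degree g + degree h) = lead_coeff g * lead_coeff h"
proof -
  have "coeff ((t_mult \<delta> ^^ i) h) (degree g + degree h) = 0" if "i < degree g" for i
    using degree_t_mult_funpow_le[OF assms, of i h] that by (intro coeff_eq_0) linarith
  then show ?thesis
    by (simp add: skew_mult_def coeff_sum coeff_t_mult_funpow[OF assms]
        lessThan_Suc_atMost[symmetric])
qed

lemma degree_skew_mult_le: "derivation \<delta> \<Longrightarrow> degree (skew_mult \<delta> g h) \<le> degree g + degree h"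
  unfolding skew_mult_def
proof (rule degree_sum_le)
  fix i assume "derivation \<delta>" "i \<in> {..degree g}"
  with degree_t_mult_funpow_le[of \<delta> i h]
  show "degree (Polynomial.smult (coeff g i) ((t_mult \<delta> ^^ i) h)) \<le> degree g + degree h"
    by (meson add_le_mono1 atMost_iff degree_smult_le order.trans)
qed simp

lemma right_division_exists:
  assumes \<delta>: "derivation \<delta>" and f: "f \<noteq> 0"
  shows "\<exists>q r. h = skew_mult \<delta> q f + r \<and> (r = 0 \<or> degree r < degree f)"
proof (induction "degree h" arbitrary: h rule: less_induct)
  case less
  show ?case
  proof (cases "h = 0 \<or> degree h < degree f")
    case True
    then show ?thesis
      by (intro exI[of _ 0] exI[of _ h]) (simp add: skew_mult_0_left)
  next
    case False
    define q where "q = Polynomial.monom (lead_coeff h / lead_coeff f) (degree h - degree f)"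
    define h' where "h' = h - skew_mult \<delta> q f"
    have q: "degree q = degree h - degree f" "lead_coeff q = lead_coeff h / lead_coeff f"
      using False f by (simp_all add: q_def degree_monom_eq)
    have "degree h' \<le> degree h"
      unfolding h'_def using degree_skew_mult_le[OF \<delta>, of q f] q False by (intro degree_diff_le) auto
    moreover have "coeff h' (degree h) = 0"
      using coeff_skew_mult_degree[OF \<delta>, of q f] q False f by (simp add: h'_def)
    ultimately consider "h' = 0" | "degree h' < degree h"
      by (metis le_neq_implies_less leading_coeff_0_iff)
    then have "\<exists>q' r. h' = skew_mult \<delta> q' f + r \<and> (r = 0 \<or> degree r < degree f)"
    proof cases
      case 1
      then show ?thesis by (intro exI[of _ 0]) (simp add: skew_mult_0_left)
    next
      case 2
      then show ?thesis by (rule less)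
    qed
    then obtain q' r where "h' = skew_mult \<delta> q' f + r" "r = 0 \<or> degree r < degree f"
      by blast
    then have "h = skew_mult \<delta> (q + q') f + r" "r = 0 \<or> degree r < degree f"
      by (simp_all add: h'_def skew_mult_add_left algebra_simps)
    then show ?thesis by blast
  qed
qed

lemma right_division_unique:
  assumes \<delta>: "derivation \<delta>"
    and eq: "skew_mult \<delta> q f + r = skew_mult \<delta> q' f + r'"
    and r: "r = 0 \<or> degree r < degree f" and r': "r' = 0 \<or> degree r' < degree f"
    and f: "f \<noteq> 0"
  shows "q = q'" and "r = r'"
proof -
  have *: "skew_mult \<delta> (q - q') f = r' - r"
    using skew_mult_add_left[of \<delta> "q - q'" q' f] eq by (simp add: algebra_simps)
  show "q = q'"
  proof (rule ccontr)
    assume "q \<noteq> q'"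
    then have "lead_coeff (q - q') * lead_coeff f \<noteq> 0"
      using f by (metis eq_iff_diff_eq_0 leading_coeff_0_iff mult_eq_0_iff)
    then have "coeff (r' - r) (degree (q - q') + degree f) \<noteq> 0"
      using coeff_skew_mult_degree[OF \<delta>, of "q - q'" f] * by metis
    moreover have "coeff r (degree (q - q') + degree f) = 0" "coeff r' (degree (q - q') + degree f) = 0"
      using r r' by (metis coeff_0 coeff_eq_0 trans_less_add2)+
    ultimately show False by simp
  qed
  with eq show "r = r'" by simp
qed

text \<open>Remainder of right division; since \<open>degree 0 = 0\<close> here, the zero remainder is admitted
  separately.\<close>

definition rmod :: "('a::field \<Rightarrow> 'a) \<Rightarrow> 'a poly \<Rightarrow> 'a poly \<Rightarrow> 'a poly" where
  "rmod \<delta> h f =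
     (THE r. (\<exists>q. h = skew_mult \<delta> q f + r) \<and> (r = 0 \<or> degree r < degree f))"

lemma rmod_eqI:
  assumes "derivation \<delta>" "f \<noteq> 0" "h = skew_mult \<delta> q f + r" "r = 0 \<or> degree r < degree f"
  shows "rmod \<delta> h f = r"
  unfolding rmod_def using assms by (intro the_equality) (blast, metis right_division_unique(2))

definition Vp :: "('a::field \<Rightarrow> 'a) \<Rightarrow> nat \<Rightarrow> 'a \<Rightarrow> 'a" where
  "Vp \<delta> p b =
     (THE v. [:- b, 1:] [^]\<^bsub>diff_poly_ring \<delta>\<^esub> p = [:0, 1:] [^]\<^bsub>diff_poly_ring \<delta>\<^esub> p - [:v:])"

text \<open>This is \<open>G\<^bsub>id,-1\<^esub>\<close>; the powers of \<open>t - 1\<close> are those of the skew ring.\<close>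

definition G_shift :: "('a::field \<Rightarrow> 'a) \<Rightarrow> 'a poly \<Rightarrow> 'a poly" where
  "G_shift \<delta> h =
     (\<Sum>i\<le>degree h. Polynomial.smult (coeff h i) ([:- 1, 1:] [^]\<^bsub>diff_poly_ring \<delta>\<^esub> i))"

locale unital_nonassoc_algebra = vectorspace F A for F and A (structure) +
  assumes mult_closed: "\<lbrakk>x \<in> carrier A; y \<in> carrier A\<rbrakk> \<Longrightarrow> x \<otimes> y \<in> carrier A"
    and mult_add_left: "\<lbrakk>x \<in> carrier A; y \<in> carrier A; z \<in> carrier A\<rbrakk>
      \<Longrightarrow> (x \<oplus> y) \<otimes> z = x \<otimes> z \<oplus> y \<otimes> z"
    and mult_add_right: "\<lbrakk>x \<in> carrier A; y \<in> carrier A; z \<in> carrier A\<rbrakk>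
      \<Longrightarrow> x \<otimes> (y \<oplus> z) = x \<otimes> y \<oplus> x \<otimes> z"
    and mult_smult_left: "\<lbrakk>c \<in> carrier F; x \<in> carrier A; y \<in> carrier A\<rbrakk>
      \<Longrightarrow> (c \<odot> x) \<otimes> y = c \<odot> (x \<otimes> y)"
    and mult_smult_right: "\<lbrakk>c \<in> carrier F; x \<in> carrier A; y \<in> carrier A\<rbrakk>
      \<Longrightarrow> x \<otimes> (c \<odot> y) = c \<odot> (x \<otimes> y)"
    and one_in_carrier: "\<one> \<in> carrier A"
    and mult_one_left: "x \<in> carrier A \<Longrightarrow> \<one> \<otimes> x = x"
    and mult_one_right: "x \<in> carrier A \<Longrightarrow> x \<otimes> \<one> = x"

definition division_algebra :: "('c, 'b, 'm) module_scheme \<Rightarrow> bool" where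
  "division_algebra A \<longleftrightarrow>
     carrier A \<noteq> {\<zero>\<^bsub>A\<^esub>} \<and>
     (\<forall>a \<in> carrier A - {\<zero>\<^bsub>A\<^esub>}.
        bij_betw (\<lambda>x. a \<otimes>\<^bsub>A\<^esub> x) (carrier A) (carrier A) \<and>
        bij_betw (\<lambda>x. x \<otimes>\<^bsub>A\<^esub> a) (carrier A) (carrier A))"

text \<open>As in the library's \<open>AutoGroup\<close>, automorphisms are represented by functions that are
  extensional on the carrier. Preservation of the unit follows from bijectivity.\<close>

definition alg_auto ::
  "('c, 'r) ring_scheme \<Rightarrow> ('c, 'b, 'm) module_scheme \<Rightarrow> ('b \<Rightarrow> 'b) set" where
  "alg_auto F A = module_hom F A A \<inter> hom A A \<inter> Bij (carrier A)"

definition alg_AutGroup ::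
  "('c, 'r) ring_scheme \<Rightarrow> ('c, 'b, 'm) module_scheme \<Rightarrow> ('b \<Rightarrow> 'b) monoid" where
  "alg_AutGroup F A = BijGroup (carrier A) \<lparr>carrier := alg_auto F A\<rparr>"

lemma (in unital_nonassoc_algebra) group_alg_AutGroup: "group (alg_AutGroup F A)"
proof -
  interpret B: group "BijGroup (carrier A)" by (rule group_BijGroup)
  have "subgroup (alg_auto F A) (BijGroup (carrier A))"
  proof (rule B.subgroupI)
    show "alg_auto F A \<subseteq> carrier (BijGroup (carrier A))"
      by (auto simp: alg_auto_def BijGroup_def)
    have "(\<lambda>x\<in>carrier A. x) \<in> alg_auto F A"
      by (auto simp: alg_auto_def module_hom_def hom_def id_Bij mult_closed)
    then show "alg_auto F A \<noteq> {}" by blast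
  next
    fix g assume g: "g \<in> alg_auto F A"
    then have gB: "g \<in> Bij (carrier A)"
      and add: "\<And>x y. x \<in> carrier A \<Longrightarrow> y \<in> carrier A \<Longrightarrow> g (x \<oplus> y) = g x \<oplus> g y"
      and mlt: "\<And>x y. x \<in> carrier A \<Longrightarrow> y \<in> carrier A \<Longrightarrow> g (x \<otimes> y) = g x \<otimes> g y"
      and sm: "\<And>c x. c \<in> carrier F \<Longrightarrow> x \<in> carrier A \<Longrightarrow> g (c \<odot> x) = c \<odot> g x"
      by (auto simp: alg_auto_def module_hom_def hom_def)
    let ?i = "inv_into (carrier A) g"
    have i: "?i x \<in> carrier A" "g (?i x) = x" if "x \<in> carrier A" for x
      using gB that by (auto simp: Bij_def bij_betw_def inv_into_into f_inv_into_f)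
    have gi: "?i (g x) = x" if "x \<in> carrier A" for x
      using gB that by (auto simp: Bij_def bij_betw_def inv_into_f_f)
    have "?i (x \<oplus> y) = ?i x \<oplus> ?i y" "?i (x \<otimes> y) = ?i x \<otimes> ?i y"
      if "x \<in> carrier A" "y \<in> carrier A" for x y
      using add[of "?i x" "?i y"] mlt[of "?i x" "?i y"] i[OF that(1)] i[OF that(2)]
        gi[of "?i x \<oplus> ?i y"] gi[of "?i x \<otimes> ?i y"] mult_closed[of "?i x" "?i y"]
      by auto
    moreover have "?i (c \<odot> x) = c \<odot> ?i x" if "c \<in> carrier F" "x \<in> carrier A" for c x
      using sm[of c "?i x"] i[OF that(2)] that gi[of "c \<odot> ?i x"] by auto
    ultimately have "(\<lambda>x\<in>carrier A. ?i x) \<in> alg_auto F A"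
      using restrict_inv_into_Bij[OF gB] i mult_closed
      by (auto simp: alg_auto_def module_hom_def hom_def)
    then show "inv\<^bsub>BijGroup (carrier A)\<^esub> g \<in> alg_auto F A"
      using inv_BijGroup[OF gB] by simp
  next
    fix g h assume "g \<in> alg_auto F A" "h \<in> alg_auto F A"
    then show "g \<otimes>\<^bsub>BijGroup (carrier A)\<^esub> h \<in> alg_auto F A"
      by (auto simp: alg_auto_def module_hom_def hom_def BijGroup_def compose_Bij)
         (auto simp: compose_def Pi_def mult_closed)
  qed
  then show ?thesis
    unfolding alg_AutGroup_def by (rule B.subgroup_imp_group)
qed

text \<open>Intended for monic \<open>f\<close> of degree at least 2; the scalars are restricted to \<open>F\<close> by viewing it
  as an algebra over \<open>const_field \<delta>\<close>.\<close>

definition petit_algebra :: "('a::field \<Rightarrow> 'a) \<Rightarrow> 'a poly \<Rightarrow> ('a, 'a poly) module" where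
  "petit_algebra \<delta> f =
     \<lparr>carrier = {h. degree h < degree f}, mult = (\<lambda>h k. rmod \<delta> (skew_mult \<delta> h k) f),
      one = 1, zero = 0, add = (+), smult = Polynomial.smult\<rparr>"

text \<open>The algebra \<open>(K, \<delta>, d) = S\<^sub>f\<close> with \<open>f = t\<^sup>p - t - d\<close>.\<close>

definition diff_algebra :: "('a::field \<Rightarrow> 'a) \<Rightarrow> nat \<Rightarrow> 'a \<Rightarrow> ('a, 'a poly) module" where
  "diff_algebra \<delta> p d =
     petit_algebra \<delta> (Polynomial.monom 1 p - Polynomial.monom 1 1 - [:d:])"

text \<open>\<open>G\<^bsub>id,-1\<^esub>\<close> does not change degrees, so the map it induces on \<open>S\<^sub>f\<close> is its restriction to the
  representatives of degree less than \<open>p\<close>.\<close>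

definition G_ind :: "('a::field \<Rightarrow> 'a) \<Rightarrow> nat \<Rightarrow> 'a \<Rightarrow> 'a poly \<Rightarrow> 'a poly" where
  "G_ind \<delta> p d = restrict (G_shift \<delta>) (carrier (diff_algebra \<delta> p d))"

end

theory Submission
  imports "HOL-Algebra.Multiplicative_Group" Defs
begin

hide_const (open) Polynomial.order

text \<open>
  Write \<open>R = K[t;\<delta>]\<close> and \<open>f = t\<^sup>p - t - d\<close>. Since \<open>t\<^sup>p - t\<close> splits over the prime field, \<open>\<delta>\<close> is
  diagonalisable; its eigenvalues form a nonzero subgroup of the prime field, so some \<open>x \<noteq> 0\<close> has
  \<open>\<delta> x = x\<close>, and \<open>1, x, \<dots>, x\<^sup>p\<^sup>-\<^sup>1\<close> is a basis of \<open>K\<close> over \<open>F\<close>.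

  The translations \<open>t \<mapsto> t + c\<close> with \<open>c\<close> in the prime field are automorphisms of \<open>R\<close> that fix \<open>K\<close>
  and \<open>f\<close>, so they act on \<open>S\<^sub>f\<close>.

  \<open>S\<^sub>f\<close> has no zero divisors iff \<open>f\<close> is irreducible. Let \<open>h\<close> be a nonconstant right factor of \<open>f\<close> of
  least degree \<open>m\<close>. Conjugation by \<open>x\<close> is a translation, so all conjugates of \<open>h\<close> by powers of \<open>x\<close> are
  right factors of \<open>f\<close>, and a least common left multiple of some of them has degree a multiple of
  \<open>m\<close>. The largest of these is translation invariant, hence of degree \<open>p\<close>. So \<open>m\<close> divides \<open>p\<close>: either \<open>f\<close>
  is irreducible or it has a right factor \<open>t - z\<close>, which means \<open>V\<^sub>p(z) - z = d\<close>.

  The formula \<open>V\<^sub>p(b) = b\<^sup>p + \<delta>\<^sup>p\<^sup>-\<^sup>1(b)\<close> is obtained by following Jacobson: expand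
  \<open>(\<delta> + X b)\<^sup>p(1)\<close> as a polynomial in a parameter \<open>X\<close> and compute its derivative in \<open>X\<close>, which is
  the constant \<open>\<delta>\<^sup>p\<^sup>-\<^sup>1(b)\<close>.
\<close>

section \<open>Dimension counts in spaces of polynomials of bounded degree\<close>

text \<open>Stated by coefficients because \<open>degree 0 = 0\<close>: zero belongs even to
  \<open>polys_below 0\<close>, and closure under sums is immediate.\<close>

definition polys_below :: "nat \<Rightarrow> 'a::field poly set" where
  "polys_below n = {u. \<forall>i\<ge>n. coeff u i = 0}"

lemma polys_below_iff: "u \<in> polys_below n \<longleftrightarrow> u = 0 \<or> degree u < n"
  unfolding polys_below_def
  by (auto simp: coeff_eq_0) (metis leading_coeff_0_iff not_le)

text \<open>The monomials below \<open>m\<close> have independent images in the span of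
  \<open>n\<close> monomials. This compares degrees of generators of left ideals without forming
  quotient modules.\<close>

lemma linear_inj_polys_below_le:
  fixes T :: "'a::field poly \<Rightarrow> 'a poly"
  assumes add: "\<And>u v. T (u + v) = T u + T v"
    and scale: "\<And>c u. T (Polynomial.smult c u) = Polynomial.smult c (T u)"
    and range: "\<And>u. u \<in> polys_below m \<Longrightarrow> T u \<in> polys_below n"
    and inj: "\<And>u. u \<in> polys_below m \<Longrightarrow> T u = 0 \<Longrightarrow> u = 0"
  shows "m \<le> n"
proof -
  interpret V: vector_space "Polynomial.smult :: 'a \<Rightarrow> 'a poly \<Rightarrow> 'a poly"
    by unfold_locales (simp_all add: smult_add_right smult_add_left)
  have T0: "T 0 = 0"
    using scale[of 0 0] by simp
  have T_sum: "T (sum g I) = (\<Sum>i\<in>I. T (g i))" for g :: "nat \<Rightarrow> 'a poly" and I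
    by (induction I rule: infinite_finite_induct) (simp_all add: T0 add)
  let ?e = "\<lambda>i::nat. Polynomial.monom (1::'a) i"
  have zero: "\<forall>i<m. u i = 0" if "(\<Sum>i<m. Polynomial.smult (u i) (T (?e i))) = 0" for u
  proof -
    define w where "w = (\<Sum>i<m. Polynomial.smult (u i) (?e i))"
    have cw: "coeff w k = (if k < m then u k else 0)" for k
      by (simp add: w_def coeff_sum if_distrib[of "\<lambda>y. _ * y"] cong: if_cong)
    have "T w = 0"
      using that by (simp add: w_def T_sum scale)
    moreover have "w \<in> polys_below m"
      by (simp add: polys_below_def cw)
    ultimately have "w = 0"
      using inj by blast
    then show ?thesis
      using cw by (metis coeff_0)
  qed
  have inj_e: "inj_on (\<lambda>i. T (?e i)) {..<m}"
  proof (rule inj_onI)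
    fix i j assume ij: "i \<in> {..<m}" "j \<in> {..<m}" "T (?e i) = T (?e j)"
    have "(\<Sum>k<m. Polynomial.smult ((if k = i then 1 else 0) - (if k = j then 1 else 0)) (T (?e k))) = 0"
      using ij by (simp add: smult_diff_left sum_subtractf if_distrib[of "\<lambda>y. Polynomial.smult y _"] cong: if_cong)
    from zero[OF this] ij(1) show "i = j"
      by (auto split: if_splits)
  qed
  let ?S = "(\<lambda>i. T (?e i)) ` {..<m}"
  have "V.independent ?S"
  proof (subst V.dependent_finite, simp, clarsimp)
    fix u i
    assume "(\<Sum>v\<in>?S. Polynomial.smult (u v) v) = 0" "i < m" "u (T (?e i)) \<noteq> 0"
    then show False
      using zero[of "\<lambda>i. u (T (?e i))"] by (simp add: sum.reindex[OF inj_e])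
  qed
  moreover have "?S \<subseteq> V.span (?e ` {..<n})"
  proof
    fix v assume "v \<in> ?S"
    then obtain i where "i < m" "v = T (?e i)" by blast
    then have v: "v \<in> polys_below n"
      using range[of "?e i"] by (simp add: polys_below_def)
    have "v = (\<Sum>i<n. Polynomial.smult (coeff v i) (?e i))"
      using v by (intro poly_eqI)
        (auto simp: polys_below_def coeff_sum if_distrib[of "\<lambda>y. _ * y"] cong: if_cong)
    also have "\<dots> \<in> V.span (?e ` {..<n})"
      by (intro V.span_sum V.span_scale V.span_base) auto
    finally show "v \<in> V.span (?e ` {..<n})" .
  qed
  ultimately have "card ?S \<le> card (?e ` {..<n})"
    using V.independent_span_bound by blast
  also have "\<dots> \<le> n"
    using card_image_le[of "{..<n}" ?e] by simp
  finally show ?thesis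
    by (simp add: card_image[OF inj_e])
qed

section \<open>Right division, left ideals and common right factors in
  \<open>K[t;\<delta>]\<close>\<close>

locale differential_field =
  fixes \<delta> :: "'a::field \<Rightarrow> 'a"
  assumes deriv: "derivation \<delta>"
begin

abbreviation skew_times (infixl "\<star>" 70) where "g \<star> h \<equiv> skew_mult \<delta> g h"

definition left_multiples :: "'a poly \<Rightarrow> 'a poly set" where
  "left_multiples g = range (\<lambda>q. q \<star> g)"

lemma left_multiplesI: "q \<star> g \<in> left_multiples g"
  by (simp add: left_multiples_def)

lemma left_multiples_self: "g \<in> left_multiples g"
  using left_multiplesI[of 1 g] by (simp add: skew_mult_1_left)

lemma deriv_add: "\<delta> (a + b) = \<delta> a + \<delta> b"
  and deriv_mult: "\<delta> (a * b) = \<delta> a * b + a * \<delta> b"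
  using deriv by (simp_all add: derivation_def)

lemmas deriv_0 [simp] = derivation_0[OF deriv]
lemmas deriv_1 [simp] = derivation_1[OF deriv]
lemmas skew_assoc = skew_mult_assoc[OF deriv]
lemmas skew_add_right = skew_mult_add_right[OF deriv]
lemmas skew_1_right = skew_mult_1_right[OF deriv]

lemma deriv_minus: "\<delta> (- a) = - \<delta> a"
  using deriv_add[of a "- a"] by (simp add: eq_neg_iff_add_eq_0 add.commute)

lemma deriv_diff: "\<delta> (a - b) = \<delta> a - \<delta> b"
  using deriv_add[of a "- b"] by (simp add: deriv_minus)

lemma deriv_sum: "\<delta> (sum g I) = (\<Sum>i\<in>I. \<delta> (g i))"
  by (induction I rule: infinite_finite_induct) (simp_all add: deriv_add)

lemma deriv_of_nat [simp]: "\<delta> (of_nat n) = 0"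
  by (induction n) (simp_all add: deriv_add)

lemma skew_0_right [simp]: "g \<star> 0 = 0"
  using skew_add_right[of g 0 0] by (metis add.right_neutral add_left_cancel)

lemma skew_minus_left: "(- g) \<star> h = - (g \<star> h)"
  using skew_mult_add_left[of \<delta> g "- g" h]
  by (simp add: skew_mult_0_left eq_neg_iff_add_eq_0 add.commute)

lemma skew_diff_left: "(g - g') \<star> h = g \<star> h - g' \<star> h"
  using skew_mult_add_left[of \<delta> g "- g'" h] by (simp add: skew_minus_left)

lemma skew_eq_0_iff [simp]: "g \<star> h = 0 \<longleftrightarrow> g = 0 \<or> h = 0"
  using coeff_skew_mult_degree[OF deriv, of g h]
  by (auto simp: skew_mult_0_left)

lemma degree_skew: "g \<noteq> 0 \<Longrightarrow> h \<noteq> 0 \<Longrightarrow> degree (g \<star> h) = degree g + degree h"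
  using coeff_skew_mult_degree[OF deriv, of g h] degree_skew_mult_le[OF deriv, of g h]
  by (metis le_antisym le_degree leading_coeff_0_iff mult_eq_0_iff)

lemma degree_left_multiples_ge:
  "r \<in> left_multiples g \<Longrightarrow> r \<noteq> 0 \<Longrightarrow> degree g \<le> degree r"
  by (auto simp: left_multiples_def degree_skew)

lemma left_multiples_below: "r \<in> left_multiples g \<Longrightarrow> r \<in> polys_below (degree g) \<Longrightarrow> r = 0"
  using degree_left_multiples_ge by (fastforce simp: polys_below_iff)

lemma left_multiples_add:
  "r \<in> left_multiples g \<Longrightarrow> s \<in> left_multiples g \<Longrightarrow> r + s \<in> left_multiples g"
  unfolding left_multiples_def by (auto simp flip: skew_mult_add_left)

lemma left_multiples_skew: "r \<in> left_multiples g \<Longrightarrow> s \<star> r \<in> left_multiples g"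
  unfolding left_multiples_def by (auto simp flip: skew_assoc)

lemma left_multiples_skew_right: "r \<in> left_multiples g \<Longrightarrow> r \<star> h \<in> left_multiples (g \<star> h)"
  unfolding left_multiples_def by (auto simp: skew_assoc)

lemma left_multiples_trans:
  "r \<in> left_multiples g \<Longrightarrow> g \<in> left_multiples h \<Longrightarrow> r \<in> left_multiples h"
  unfolding left_multiples_def by (auto simp flip: skew_assoc)

lemma rmod_cases:
  assumes "f \<noteq> 0"
  obtains q where "h = q \<star> f + rmod \<delta> h f" "rmod \<delta> h f \<in> polys_below (degree f)"
  using right_division_exists[OF deriv assms, of h] rmod_eqI[OF deriv assms, of h] that
  by (metis polys_below_iff)

lemma rmod_unique:
  "f \<noteq> 0 \<Longrightarrow> h = q \<star> f + r \<Longrightarrow> r \<in> polys_below (degree f) \<Longrightarrow> rmod \<delta> h f = r"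
  by (rule rmod_eqI[OF deriv]) (auto simp: polys_below_iff)

lemma rmod_below: "f \<noteq> 0 \<Longrightarrow> h \<in> polys_below (degree f) \<Longrightarrow> rmod \<delta> h f = h"
  by (rule rmod_unique[of f h 0 h]) (simp_all add: skew_mult_0_left)

lemma rmod_add:
  assumes "f \<noteq> 0"
  shows "rmod \<delta> (h + k) f = rmod \<delta> h f + rmod \<delta> k f"
proof -
  obtain q r q' r' where "h = q \<star> f + r" "r \<in> polys_below (degree f)"
    and "k = q' \<star> f + r'" "r' \<in> polys_below (degree f)"
    using rmod_cases[OF assms] by metis
  moreover from this have "rmod \<delta> (h + k) f = r + r'"
    by (intro rmod_unique[OF assms, of _ "q + q'"])
      (auto simp: skew_mult_add_left polys_below_def)
  ultimately show ?thesis
    by (simp add: rmod_unique[OF assms])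
qed

lemma rmod_smult:
  assumes "f \<noteq> 0"
  shows "rmod \<delta> (Polynomial.smult c h) f = Polynomial.smult c (rmod \<delta> h f)"
proof -
  obtain q r where "h = q \<star> f + r" "r \<in> polys_below (degree f)"
    using rmod_cases[OF assms] by metis
  moreover from this have "rmod \<delta> (Polynomial.smult c h) f = Polynomial.smult c r"
    by (intro rmod_unique[OF assms, of _ "Polynomial.smult c q"])
      (auto simp: skew_mult_smult_left polys_below_def smult_add_right)
  ultimately show ?thesis
    by (simp add: rmod_unique[OF assms])
qed

lemma rmod_eq_0_iff:
  assumes "f \<noteq> 0"
  shows "rmod \<delta> h f = 0 \<longleftrightarrow> h \<in> left_multiples f"
proof
  assume "rmod \<delta> h f = 0"
  then show "h \<in> left_multiples f"
    using rmod_cases[OF assms, of h] by (auto intro: left_multiplesI)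
next
  assume "h \<in> left_multiples f"
  then show "rmod \<delta> h f = 0"
    by (auto simp: left_multiples_def polys_below_def intro!: rmod_unique[OF assms])
qed

text \<open>An element of least degree generates, since remainders of right division by it stay in
  the ideal; a left scalar makes it monic.\<close>

lemma left_ideal_principal:
  assumes nz: "r \<in> I" "r \<noteq> 0"
    and add: "\<And>u v. u \<in> I \<Longrightarrow> v \<in> I \<Longrightarrow> u + v \<in> I"
    and mult: "\<And>u v. v \<in> I \<Longrightarrow> u \<star> v \<in> I"
  obtains g where "lead_coeff g = 1" "I = left_multiples g"
proof -
  obtain g where g: "g \<in> I" "g \<noteq> 0" and least: "\<And>u. u \<in> I \<Longrightarrow> u \<noteq> 0 \<Longrightarrow> degree g \<le> degree u"
    using ex_has_least_nat[of "\<lambda>u. u \<in> I \<and> u \<noteq> 0" r degree] nz by auto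
  define g' where "g' = [:inverse (lead_coeff g):] \<star> g"
  have g': "g' \<in> I" "lead_coeff g' = 1" "degree g' = degree g"
    using g by (simp_all add: g'_def mult) (simp_all add: skew_mult_const_left)
  then have "g' \<noteq> 0" by auto
  have "u \<in> left_multiples g'" if u: "u \<in> I" for u
  proof -
    obtain q where q: "u = q \<star> g' + rmod \<delta> u g'" "rmod \<delta> u g' \<in> polys_below (degree g')"
      using rmod_cases[OF \<open>g' \<noteq> 0\<close>] by metis
    have "rmod \<delta> u g' = u - q \<star> g'"
      using q(1) by (metis add_diff_cancel_left')
    then have "rmod \<delta> u g' = u + (- q) \<star> g'"
      by (simp add: skew_minus_left)
    then have "rmod \<delta> u g' \<in> I"
      using add[OF u mult[OF g'(1)]] by simp
    then have "rmod \<delta> u g' = 0"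
      using least q(2) g'(3) by (fastforce simp: polys_below_iff)
    then show ?thesis
      by (simp add: rmod_eq_0_iff[OF \<open>g' \<noteq> 0\<close>])
  qed
  then have "I = left_multiples g'"
    using g'(1) mult by (auto simp: left_multiples_def)
  with g'(2) show thesis using that by blast
qed

text \<open>The map \<open>r \<mapsto> r \<star> l\<close> induces an isomorphism of left modules \<open>R/Ru \<rightarrow> R/Rh\<close>, with inverse
  induced by \<open>s \<mapsto> s \<star> a\<close>; degrees are the dimensions over \<open>K\<close> of these modules.\<close>

lemma annihilator_mod_coprime:
  assumes h: "h \<noteq> 0" and bezout: "a \<star> l + b \<star> h = 1"
  obtains u where "lead_coeff u = 1" "degree u = degree h"
    "{r. r \<star> l \<in> left_multiples h} = left_multiples u"
proof -
  let ?T = "\<lambda>r. rmod \<delta> (r \<star> l) h"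
  let ?I = "{r. r \<star> l \<in> left_multiples h}"
  have below: "rmod \<delta> u h \<in> polys_below (degree h)" for u
    using rmod_cases[OF h] by blast
  have T_add: "?T (u + v) = ?T u + ?T v" for u v
    by (simp add: skew_mult_add_left rmod_add[OF h])
  have T_smult: "?T (Polynomial.smult c u) = Polynomial.smult c (?T u)" for c u
    by (simp add: skew_mult_smult_left rmod_smult[OF h])
  \<comment> \<open>\<open>?T\<close> maps a space of dimension \<open>degree h + 1\<close> into one
    of dimension \<open>degree h\<close>, so it has a kernel.\<close>
  have "\<exists>r. r \<in> ?I \<and> r \<noteq> 0"
  proof (rule ccontr)
    assume "\<nexists>r. r \<in> ?I \<and> r \<noteq> 0"
    then have "Suc (degree h) \<le> degree h"
      by (intro linear_inj_polys_below_le[of ?T] T_add T_smult below)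
        (auto simp: rmod_eq_0_iff[OF h])
    then show False by simp
  qed
  then obtain r where "r \<in> ?I" "r \<noteq> 0" by blast
  then obtain u where u: "lead_coeff u = 1" "?I = left_multiples u"
    by (rule left_ideal_principal)
      (auto simp: skew_mult_add_left left_multiples_add skew_assoc left_multiples_skew)
  then have u0: "u \<noteq> 0" by auto
  have "degree u \<le> degree h"
  proof (rule linear_inj_polys_below_le[of ?T, OF T_add T_smult below])
    fix v assume v: "v \<in> polys_below (degree u)" "?T v = 0"
    then have "v \<in> left_multiples u"
      using u(2) by (auto simp: rmod_eq_0_iff[OF h])
    then show "v = 0"
      using v(1) left_multiples_below by blast
  qed
  \<comment> \<open>If \<open>s \<star> a\<close> annihilates \<open>l\<close> modulo
    \<open>h\<close>, the Bezout identity multiplied by \<open>s\<close> puts \<open>s\<close>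
    itself into the left ideal of \<open>h\<close>.\<close>
  moreover have "degree h \<le> degree u"
  proof (rule linear_inj_polys_below_le[of "\<lambda>s. rmod \<delta> (s \<star> a) u"])
    show "rmod \<delta> (s \<star> a) u \<in> polys_below (degree u)" for s
      using rmod_cases[OF u0] by blast
  next
    fix s assume s: "s \<in> polys_below (degree h)" "rmod \<delta> (s \<star> a) u = 0"
    then have "s \<star> a \<in> ?I"
      using u(2) by (simp add: rmod_eq_0_iff[OF u0])
    moreover have "s = s \<star> a \<star> l + s \<star> b \<star> h"
      using arg_cong[OF bezout, of "\<lambda>v. s \<star> v"] by (simp add: skew_add_right skew_1_right skew_assoc)
    ultimately have "s \<in> left_multiples h"
      by (metis left_multiples_add left_multiplesI mem_Collect_eq)
    then show "s = 0"
      using s(1) left_multiples_below by blast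
  qed (simp_all add: skew_mult_add_left rmod_add[OF u0] skew_mult_smult_left rmod_smult[OF u0])
  ultimately show thesis
    using that u by (simp add: le_antisym)
qed

text \<open>The left ideal generated by \<open>l\<close> and \<open>h\<close> is principal; its
  generator is their greatest common right divisor.\<close>

lemma bezout_left:
  assumes "l \<noteq> 0"
  obtains g a b where "lead_coeff g = 1" "l \<in> left_multiples g" "h \<in> left_multiples g"
    "g = a \<star> l + b \<star> h"
proof -
  let ?I = "{a \<star> l + b \<star> h |a b. True}"
  have l: "l \<in> ?I" and h: "h \<in> ?I"
    by (rule CollectI, rule exI[of _ 1], rule exI[of _ 0], simp add: skew_mult_1_left skew_mult_0_left)
      (rule CollectI, rule exI[of _ 0], rule exI[of _ 1], simp add: skew_mult_1_left skew_mult_0_left)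
  obtain g where g: "lead_coeff g = 1" "?I = left_multiples g"
  proof (rule left_ideal_principal[OF l assms])
    fix u v assume "u \<in> ?I" "v \<in> ?I"
    then obtain a b a' b' where "u = a \<star> l + b \<star> h" "v = a' \<star> l + b' \<star> h" by blast
    then have "u + v = (a + a') \<star> l + (b + b') \<star> h"
      by (simp add: skew_mult_add_left)
    then show "u + v \<in> ?I" by blast
  next
    fix u v assume "v \<in> ?I"
    then obtain a b where "v = a \<star> l + b \<star> h" by blast
    then have "u \<star> v = (u \<star> a) \<star> l + (u \<star> b) \<star> h"
      by (simp add: skew_add_right skew_assoc)
    then show "u \<star> v \<in> ?I" by blast
  qed
  have "g \<in> ?I"
    unfolding g(2) by (rule left_multiples_self)
  then show thesis
    using that g l h by blast
qed

end

section \<open>Polynomials in \<open>\<delta>\<close> as operators on \<open>K\<close>\<close>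

lemma poly_at_map_altdef:
  assumes "degree q \<le> n"
  shows "poly_at_map q \<delta> z = (\<Sum>i\<le>n. coeff q i * (\<delta> ^^ i) z)"
  unfolding poly_at_map_def
  by (rule sum.mono_neutral_left) (use assms in \<open>auto simp: coeff_eq_0\<close>)

context differential_field
begin

lemma funpow_deriv_minus: "(\<delta> ^^ i) (- a) = - (\<delta> ^^ i) a"
  by (induction i) (simp_all add: deriv_minus)

lemma funpow_deriv_diff: "(\<delta> ^^ i) (a - b) = (\<delta> ^^ i) a - (\<delta> ^^ i) b"
  by (induction i) (simp_all add: deriv_diff)

lemma funpow_deriv_const_mult: "\<delta> c = 0 \<Longrightarrow> (\<delta> ^^ i) (c * a) = c * (\<delta> ^^ i) a"
  by (induction i) (simp_all add: deriv_mult)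

text \<open>A constant \<open>c\<close> commutes with \<open>\<delta>\<close>, so evaluation at
  \<open>\<delta>\<close> turns the ordinary product into composition, and linear factors can be
  peeled off one at a time.\<close>

lemma poly_at_map_linear_factor:
  assumes "\<delta> c = 0"
  shows "poly_at_map ([:- c, 1:] * q) \<delta> z = poly_at_map q \<delta> (\<delta> z - c * z)"
proof -
  define n where "n = degree q"
  have "degree ([:- c, 1:] * q) \<le> Suc n"
    using degree_mult_le[of "[:- c, 1:]" q] by (simp add: n_def)
  then have "poly_at_map ([:- c, 1:] * q) \<delta> z
      = (\<Sum>i\<le>Suc n. coeff ([:- c, 1:] * q) i * (\<delta> ^^ i) z)"
    by (rule poly_at_map_altdef)
  also have "[:- c, 1:] * q = pCons 0 q - Polynomial.smult c q"
    by simp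
  also have "(\<Sum>i\<le>Suc n. coeff (pCons 0 q - Polynomial.smult c q) i * (\<delta> ^^ i) z)
      = (\<Sum>i\<le>Suc n. coeff (pCons 0 q) i * (\<delta> ^^ i) z) - (\<Sum>i\<le>Suc n. c * coeff q i * (\<delta> ^^ i) z)"
    by (simp only: coeff_diff coeff_smult left_diff_distrib sum_subtractf)
  also have "(\<Sum>i\<le>Suc n. coeff (pCons 0 q) i * (\<delta> ^^ i) z) = (\<Sum>i\<le>n. coeff q i * (\<delta> ^^ i) (\<delta> z))"
    by (subst sum.atMost_Suc_shift) (simp add: funpow_swap1)
  also have "(\<Sum>i\<le>Suc n. c * coeff q i * (\<delta> ^^ i) z) = (\<Sum>i\<le>n. coeff q i * (\<delta> ^^ i) (c * z))"
    by (simp add: n_def coeff_eq_0 funpow_deriv_const_mult[OF assms] algebra_simps)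
  finally show ?thesis
    by (simp add: poly_at_map_def n_def funpow_deriv_diff right_diff_distrib sum_subtractf)
qed

lemma deriv_power_eigenvector: "\<delta> y = c * y \<Longrightarrow> \<delta> (y ^ m) = of_nat m * c * y ^ m"
  by (induction m) (simp_all add: deriv_mult algebra_simps)

subsection \<open>Powers of linear polynomials\<close>

text \<open>This is the constant coefficient of the skew power \<open>(t + b)^n\<close>.\<close>

definition pow_one :: "'a \<Rightarrow> nat \<Rightarrow> 'a" where
  "pow_one b n = ((\<lambda>u. \<delta> u + b * u) ^^ n) 1"

lemma pow_one_0 [simp]: "pow_one b 0 = 1"
  and pow_one_Suc [simp]: "pow_one b (Suc n) = \<delta> (pow_one b n) + b * pow_one b n"
  by (simp_all add: pow_one_def)

lemma skew_linear_left: "[:b, 1:] \<star> h = Polynomial.smult b h + t_mult \<delta> h"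
proof -
  have "[:b, 1:] = [:b:] + [:0, 1:]" by simp
  then show ?thesis
    by (simp only: skew_mult_add_left skew_mult_const_left skew_mult_t_left)
qed

lemma skew_pow_Suc:
  "h [^]\<^bsub>diff_poly_ring \<delta>\<^esub> Suc n = h \<star> h [^]\<^bsub>diff_poly_ring \<delta>\<^esub> n"
proof -
  interpret R: ring "diff_poly_ring \<delta>" by (rule ring_diff_poly_ring[OF deriv])
  show ?thesis
    using R.nat_pow_Suc2[of h n] by (simp add: diff_poly_ring_def)
qed

lemma skew_pow_Suc2:
  "h [^]\<^bsub>diff_poly_ring \<delta>\<^esub> Suc n = h [^]\<^bsub>diff_poly_ring \<delta>\<^esub> n \<star> h"
  by (simp add: diff_poly_ring_def)

lemma skew_pow_0: "h [^]\<^bsub>diff_poly_ring \<delta>\<^esub> (0::nat) = 1"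
  by (simp add: diff_poly_ring_def)

text \<open>Left multiplication by \<open>t + b\<close> applies \<open>\<delta> + b\<close> to every
  coefficient and adds a degree shift. These two operations commute, so Pascal's rule yields
  binomial coefficients.\<close>

lemma coeff_linear_skew_pow:
  "coeff ([:b, 1:] [^]\<^bsub>diff_poly_ring \<delta>\<^esub> n) k = of_nat (n choose k) * pow_one b (n - k)"
proof (induction n arbitrary: k)
  case 0
  then show ?case by (cases k) (simp_all add: skew_pow_0 del: nat_pow_0)
next
  case (Suc n)
  have c: "\<delta> (of_nat m * w) = of_nat m * \<delta> w" for m w
    by (simp add: deriv_mult)
  have step: "coeff ([:b, 1:] [^]\<^bsub>diff_poly_ring \<delta>\<^esub> Suc n) k =
      (if k = 0 then 0 else of_nat (n choose (k - 1)) * pow_one b (n - (k - 1)))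
      + of_nat (n choose k) * (\<delta> (pow_one b (n - k)) + b * pow_one b (n - k))"
    unfolding skew_pow_Suc skew_linear_left coeff_add coeff_smult coeff_t_mult[OF deriv] Suc.IH c
    by (simp only: distrib_left mult.left_commute add.left_commute add.commute)
  show ?case
  proof (cases k)
    case 0
    then show ?thesis unfolding step by simp
  next
    case (Suc j)
    show ?thesis
    proof (cases "k \<le> n")
      case True
      then have "n - j = Suc (n - k)" using Suc by simp
      then show ?thesis unfolding step using Suc by (simp add: algebra_simps)
    next
      case False
      then show ?thesis unfolding step using Suc by (simp add: binomial_eq_0)
    qed
  qed
qed

section \<open>Jacobson's parameter argument for \<open>p\<close>-th powers\<close>

lemma map_poly_deriv_add: "map_poly \<delta> (u + v) = map_poly \<delta> u + map_poly \<delta> v"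
  by (rule poly_eqI) (simp add: coeff_map_poly deriv_add)

lemma map_poly_deriv_smult:
  "map_poly \<delta> (Polynomial.smult a u) = Polynomial.smult (\<delta> a) u + Polynomial.smult a (map_poly \<delta> u)"
  by (rule poly_eqI) (simp add: coeff_map_poly deriv_mult)

lemma map_poly_deriv_sum: "map_poly \<delta> (sum g I) = (\<Sum>i\<in>I. map_poly \<delta> (g i))"
  by (induction I rule: infinite_finite_induct) (simp_all add: map_poly_deriv_add)

lemma map_poly_deriv_pCons: "map_poly \<delta> (pCons a u) = pCons (\<delta> a) (map_poly \<delta> u)"
  by (rule poly_eqI) (simp add: coeff_map_poly coeff_pCons split: nat.splits)

lemma pderiv_map_poly_deriv: "pderiv (map_poly \<delta> u) = map_poly \<delta> (pderiv u)"
  by (rule poly_eqI) (simp add: coeff_map_poly coeff_pderiv deriv_mult deriv_add)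

lemma poly_map_poly_deriv_1: "poly (map_poly \<delta> u) 1 = \<delta> (poly u 1)"
  by (induction u) (simp_all add: map_poly_deriv_pCons deriv_add)

text \<open>\<open>pow_one (X * b) n\<close> for a parameter \<open>X\<close>, as a polynomial in \<open>X\<close>.\<close>

primrec pow_one_poly :: "'a \<Rightarrow> nat \<Rightarrow> 'a poly" where
  "pow_one_poly b 0 = 1"
| "pow_one_poly b (Suc n) = map_poly \<delta> (pow_one_poly b n) + [:0, b:] * pow_one_poly b n"

lemma poly_pow_one_poly: "poly (pow_one_poly b n) 1 = pow_one b n"
  by (induction n) (simp_all add: poly_map_poly_deriv_1)

lemma degree_pow_one_poly: "degree (pow_one_poly b n) \<le> n"
proof (induction n)
  case (Suc n)
  have "degree [:0, b:] \<le> 1"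
    by simp
  then have "degree ([:0, b:] * pow_one_poly b n) \<le> Suc n"
    using degree_mult_le[of "[:0, b:]" "pow_one_poly b n"] Suc by linarith
  then show ?case
    using Suc degree_map_poly_bound[of \<delta> "pow_one_poly b n"] by (auto intro!: degree_add_le)
qed simp

lemma coeff_pow_one_poly_top: "coeff (pow_one_poly b n) n = b ^ n"
proof (induction n)
  case (Suc n)
  have "coeff (pow_one_poly b n) (Suc n) = 0"
    using degree_pow_one_poly[of b n] by (simp add: coeff_eq_0)
  then show ?case
    using Suc by (simp add: coeff_map_poly)
qed simp

lemma coeff_pow_one_poly_0: "n > 0 \<Longrightarrow> coeff (pow_one_poly b n) 0 = 0"
proof (induction n)
  case (Suc n)
  then show ?case by (cases n) (simp_all add: coeff_map_poly)
qed simp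

text \<open>With \<open>D = \<delta> + X b\<close> the recursion \<open>P_(n+1) = D P_n\<close>
  differentiates to \<open>D P_n' + b P_n\<close>; now
  \<open>D (a u) = \<delta>(a) u + a D u\<close> and Pascal's rule apply.\<close>

lemma pderiv_pow_one_poly:
  "pderiv (pow_one_poly b n) =
     (\<Sum>k<n. Polynomial.smult (of_nat (n choose Suc k) * (\<delta> ^^ k) b) (pow_one_poly b (n - Suc k)))"
proof (induction n)
  case (Suc n)
  define D where "D u = map_poly \<delta> u + [:0, b:] * u" for u
  have D_sum: "D (sum g I) = (\<Sum>i\<in>I. D (g i))" for g :: "nat \<Rightarrow> 'a poly" and I
    by (simp only: D_def map_poly_deriv_sum sum_distrib_left sum.distrib)
  have D_smult: "D (Polynomial.smult a u) = Polynomial.smult (\<delta> a) u + Polynomial.smult a (D u)" for a u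
    by (simp add: D_def map_poly_deriv_smult smult_add_right algebra_simps)
  have D_step: "D (pow_one_poly b m) = pow_one_poly b (Suc m)" for m
    by (simp add: D_def)
  let ?c = "\<lambda>k. Polynomial.smult (of_nat (n choose k) * (\<delta> ^^ k) b) (pow_one_poly b (n - k))"
  let ?c' = "\<lambda>k. Polynomial.smult (of_nat (n choose Suc k) * (\<delta> ^^ k) b) (pow_one_poly b (n - k))"
  have "pderiv (pow_one_poly b (Suc n)) = D (pderiv (pow_one_poly b n)) + Polynomial.smult b (pow_one_poly b n)"
    by (simp add: D_def pderiv_add pderiv_map_poly_deriv pderiv_mult pderiv_pCons pderiv_smult smult_add_right)
  \<comment> \<open>Differentiating the scalar gives \<open>?c (Suc k)\<close>, advancing the
    polynomial gives \<open>?c' k\<close>; the extra term \<open>b P_n\<close> supplies the missing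
    \<open>?c 0\<close>.\<close>
  also have "D (pderiv (pow_one_poly b n)) = (\<Sum>k<n. ?c (Suc k) + ?c' k)"
    unfolding Suc.IH D_sum
    by (rule sum.cong[OF refl]) (simp add: D_smult D_step deriv_mult Suc_diff_Suc del: pow_one_poly.simps)
  also have "\<dots> + Polynomial.smult b (pow_one_poly b n) = (\<Sum>k<Suc n. ?c k) + (\<Sum>k<Suc n. ?c' k)"
    by (subst sum.lessThan_Suc_shift) (simp add: sum.distrib binomial_eq_0)
  also have "\<dots> = (\<Sum>k<Suc n. Polynomial.smult (of_nat (Suc n choose Suc k) * (\<delta> ^^ k) b)
      (pow_one_poly b (Suc n - Suc k)))"
    by (simp only: sum.distrib[symmetric] smult_add_left[symmetric] binomial_Suc_Suc of_nat_add
        distrib_right diff_Suc_Suc)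
  finally show ?case .
qed (simp add: pderiv_1)

text \<open>Modulo \<open>p\<close> only the summand \<open>k = p - 1\<close> of the derivative
  survives, so the derivative in the parameter is the constant
  \<open>(\<delta> ^^ (p - 1)) b\<close>. This fixes all coefficients but those at exponents 0 and
  \<open>p\<close>, which are found separately; then the parameter is set to 1.\<close>

lemma pow_one_char:
  assumes p: "prime p" "CHAR('a) = p"
  shows "pow_one b p = b ^ p + (\<delta> ^^ (p - 1)) b"
proof -
  have p2: "p \<ge> 2" using p(1) by (rule prime_ge_2_nat)
  have choose: "of_nat (p choose Suc k) = (0::'a)" if "Suc k < p" for k
    using that p by (simp add: of_nat_eq_0_iff_char_dvd dvd_choose_prime)
  have "pderiv (pow_one_poly b p) =
     (\<Sum>k\<in>{p - 1}. Polynomial.smult (of_nat (p choose Suc k) * (\<delta> ^^ k) b) (pow_one_poly b (p - Suc k)))"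
    unfolding pderiv_pow_one_poly
    by (rule sum.mono_neutral_right) (use p2 choose in auto)
  then have pd: "pderiv (pow_one_poly b p) = [:(\<delta> ^^ (p - 1)) b:]"
    using p2 by simp
  have coeff: "coeff (pow_one_poly b p) k =
      (if k = 1 then (\<delta> ^^ (p - 1)) b else if k = p then b ^ p else 0)" for k
  proof -
    have "k = 0 \<or> k = 1 \<or> (k = p \<and> k \<noteq> 1) \<or> k > p \<or> (1 < k \<and> k < p)"
      by linarith
    then consider "k = 0" | "k = 1" | "k = p" "k \<noteq> 1" | "k > p" | "1 < k" "k < p"
      by blast
    then show ?thesis
    proof cases
      case 1
      then show ?thesis using p2 by (simp add: coeff_pow_one_poly_0)
    next
      case 2
      then show ?thesis
        using arg_cong[OF pd, of "\<lambda>u. coeff u 0"] by (simp add: coeff_pderiv)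
    next
      case 3
      then show ?thesis by (simp add: coeff_pow_one_poly_top)
    next
      case 4
      then show ?thesis
        using degree_pow_one_poly[of b p] p2 by (simp add: coeff_eq_0)
    next
      case 5
      have "of_nat k * coeff (pow_one_poly b p) k = 0"
        using arg_cong[OF pd, of "\<lambda>u. coeff u (k - 1)"] 5
        by (simp add: coeff_pderiv coeff_pCons split: nat.splits)
      moreover have "of_nat k \<noteq> (0::'a)"
        using 5 p by (auto simp: of_nat_eq_0_iff_char_dvd dest: dvd_imp_le)
      ultimately show ?thesis using 5 by simp
    qed
  qed
  have "pow_one_poly b p = Polynomial.monom ((\<delta> ^^ (p - 1)) b) 1 + Polynomial.monom (b ^ p) p"
    by (rule poly_eqI) (use p2 in \<open>auto simp: coeff\<close>)
  then show ?thesis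
    using poly_pow_one_poly[of b p] by (simp add: poly_monom add.commute)
qed

text \<open>The intermediate binomial coefficients vanish modulo \<open>p\<close>, so
  \<open>(t + b)^p\<close> and \<open>t^p\<close> differ by a constant, as the definition of
  \<open>Vp\<close> presupposes.\<close>

lemma linear_skew_pow_char:
  assumes p: "prime p" "CHAR('a) = p"
  shows "[:b, 1:] [^]\<^bsub>diff_poly_ring \<delta>\<^esub> p = Polynomial.monom 1 p + [:b ^ p + (\<delta> ^^ (p - 1)) b:]"
proof (rule poly_eqI)
  fix k
  have "of_nat (p choose k) = (0::'a)" if "0 < k" "k < p"
    using that p by (simp add: of_nat_eq_0_iff_char_dvd dvd_choose_prime)
  moreover have "p > 0" using p(1) by (rule prime_gt_0_nat)
  ultimately show "coeff ([:b, 1:] [^]\<^bsub>diff_poly_ring \<delta>\<^esub> p) k =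
      coeff (Polynomial.monom 1 p + [:b ^ p + (\<delta> ^^ (p - 1)) b:]) k"
    by (cases "k < p"; cases "k = p")
      (auto simp: coeff_linear_skew_pow pow_one_char[OF p] coeff_pCons binomial_eq_0 split: nat.splits)
qed

lemma minus_power_char:
  assumes "prime p" "CHAR('a) = p"
  shows "(- a :: 'a) ^ p = - (a ^ p)"
proof -
  have "(a + - a) ^ p = a ^ p + (- a) ^ p"
    by (rule freshmans_dream) (use assms in simp_all)
  then have "a ^ p + (- a) ^ p = 0"
    using prime_gt_0_nat[OF assms(1)] by (simp add: power_0_left)
  then show ?thesis by (metis add_eq_0_iff)
qed

lemma Vp_eq:
  assumes p: "prime p" "CHAR('a) = p"
  shows "Vp \<delta> p b = b ^ p + (\<delta> ^^ (p - 1)) b"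
proof -
  have "[:- b, 1:] [^]\<^bsub>diff_poly_ring \<delta>\<^esub> p = Polynomial.monom 1 p - [:b ^ p + (\<delta> ^^ (p - 1)) b:]"
    using linear_skew_pow_char[OF p, of "- b"]
    by (simp add: minus_power_char[OF p] funpow_deriv_minus)
  moreover have "[:0, 1:] [^]\<^bsub>diff_poly_ring \<delta>\<^esub> p = Polynomial.monom 1 p"
    using linear_skew_pow_char[OF p, of 0] prime_gt_0_nat[OF p(1)] funpow_deriv_diff[of _ 0 0]
    by (simp add: power_0_left)
  ultimately show ?thesis
    unfolding Vp_def by (intro the_equality) (simp_all del: minus_pCons)
qed

subsection \<open>Translations\<close>

text \<open>For constant \<open>c\<close> the skew powers of \<open>t + c\<close> are the
  commutative ones, so ordinary composition is the substitution of \<open>t + c\<close> for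
  \<open>t\<close> in \<open>K[t;\<delta>]\<close>.\<close>

definition shift :: "'a \<Rightarrow> 'a poly \<Rightarrow> 'a poly" where
  "shift c h = pcompose h [:c, 1:]"

lemma shift_0 [simp]: "shift c 0 = 0"
  and shift_const [simp]: "shift c [:a:] = [:a:]"
  and shift_add: "shift c (g + h) = shift c g + shift c h"
  and shift_diff: "shift c (g - h) = shift c g - shift c h"
  and shift_smult: "shift c (Polynomial.smult a h) = Polynomial.smult a (shift c h)"
  and shift_pCons: "shift c (pCons a h) = [:a:] + [:c, 1:] * shift c h"
  and degree_shift [simp]: "degree (shift c h) = degree h"
  by (simp_all add: shift_def pcompose_add pcompose_diff pcompose_smult pcompose_pCons degree_pcompose)

lemma shift_shift: "shift c (shift c' h) = shift (c + c') h"
proof -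
  have "pcompose [:c', 1:] [:c, 1:] = [:c + c', 1:]"
    by (simp add: pcompose_pCons add.commute)
  then show ?thesis
    by (simp add: shift_def flip: pcompose_assoc)
qed

lemma shift_by_0: "shift 0 h = h"
  by (simp add: shift_def)

lemma shift_monom: "shift c (Polynomial.monom a n) = Polynomial.smult a ([:c, 1:] ^ n)"
proof (induction n)
  case 0
  then show ?case by (simp add: monom_0 smult_one)
next
  case (Suc n)
  then show ?case by (simp add: monom_Suc shift_pCons)
qed

lemma map_poly_deriv_shift:
  "\<delta> c = 0 \<Longrightarrow> map_poly \<delta> (shift c h) = shift c (map_poly \<delta> h)"
  by (induction h)
    (simp_all add: shift_pCons map_poly_deriv_pCons map_poly_deriv_add map_poly_deriv_smult)

lemma t_mult_constants: "map_poly \<delta> u = 0 \<Longrightarrow> t_mult \<delta> u = pCons 0 u"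
  by (simp add: t_mult_def)

text \<open>Constants commute with \<open>t\<close>. This moves computations with
  \<open>t + c\<close> into the commutative polynomial ring.\<close>

lemma skew_constants_right:
  assumes "map_poly \<delta> u = 0"
  shows "g \<star> u = g * u"
proof -
  have "(t_mult \<delta> ^^ i) u = Polynomial.monom 1 i * u \<and> map_poly \<delta> (Polynomial.monom 1 i * u) = 0" for i
    by (induction i) (simp_all add: assms monom_Suc t_mult_constants map_poly_deriv_pCons)
  then have "g \<star> u = (\<Sum>i\<le>degree g. Polynomial.monom (coeff g i) i) * u"
    by (simp add: skew_mult_def sum_distrib_right smult_monom flip: mult_smult_left)
  then show ?thesis
    by (simp add: poly_as_sum_of_monoms)
qed

lemma skew_pCons_left: "pCons a g \<star> h = Polynomial.smult a h + g \<star> t_mult \<delta> h"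
proof -
  have "g \<star> [:0, 1:] = pCons 0 g"
    by (subst skew_constants_right) (simp_all add: map_poly_deriv_pCons)
  moreover have "pCons a g = [:a:] + pCons 0 g" by simp
  ultimately have "pCons a g = [:a:] + g \<star> [:0, 1:]" by simp
  then show ?thesis
    by (simp only: skew_mult_add_left skew_mult_const_left skew_assoc skew_mult_t_left)
qed

text \<open>\<open>t + c\<close> satisfies the same commutation relation with elements of
  \<open>K\<close> as \<open>t\<close>. The induction splits the left factor as
  \<open>a + g t\<close>.\<close>

lemma shift_skew:
  assumes "\<delta> c = 0"
  shows "shift c (g \<star> h) = shift c g \<star> shift c h"
proof (induction g arbitrary: h)
  case (pCons a g)
  have "shift c (t_mult \<delta> h) = [:c, 1:] \<star> shift c h"
    by (simp add: t_mult_def skew_linear_left shift_add shift_pCons map_poly_deriv_shift[OF assms])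
  moreover have "[:c, 1:] * shift c g = shift c g \<star> [:c, 1:]"
    by (subst skew_constants_right) (simp_all add: map_poly_deriv_pCons assms mult.commute)
  ultimately show ?case
    using pCons.IH[of "t_mult \<delta> h"]
    by (simp only: skew_pCons_left shift_add shift_smult shift_pCons skew_mult_add_left
        skew_mult_const_left skew_assoc)
qed (simp add: skew_mult_0_left)

text \<open>From \<open>\<delta> x = x\<close> follows \<open>t x = x (t + 1)\<close>: conjugation
  by \<open>x\<close> is a translation.\<close>

lemma skew_eigenvector_right:
  assumes "\<delta> x = x"
  shows "g \<star> [:x:] = Polynomial.smult x (shift 1 g)"
proof (induction g)
  case (pCons a g)
  have "t_mult \<delta> [:x:] = [:x:] \<star> [:1, 1:]"
    by (simp add: t_mult_def map_poly_deriv_pCons assms skew_mult_const_left)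
  then have "pCons a g \<star> [:x:] = [:a * x:] + (g \<star> [:x:]) \<star> [:1, 1:]"
    by (simp add: skew_pCons_left skew_assoc)
  also have "\<dots> = [:a * x:] + Polynomial.smult x (shift 1 g * [:1, 1:])"
    unfolding pCons.IH by (subst skew_constants_right) (simp_all add: map_poly_deriv_pCons smult_add_right)
  finally show ?case
    by (simp add: shift_pCons smult_add_right mult.commute)
qed (simp add: skew_mult_0_left)

lemma G_shift_eq: "G_shift \<delta> h = shift (- 1) h"
proof -
  have pow: "[:- 1, 1:] [^]\<^bsub>diff_poly_ring \<delta>\<^esub> n = [:- 1, 1:] ^ n" for n
  proof (induction n)
    case 0
    then show ?case by (simp only: skew_pow_0 power_0)
  next
    case (Suc n)
    then show ?case
      unfolding skew_pow_Suc2
      by (subst skew_constants_right) (simp_all add: map_poly_deriv_pCons deriv_minus mult.commute)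
  qed
  have "shift (- 1) h = shift (- 1) (\<Sum>i\<le>degree h. Polynomial.monom (coeff h i) i)"
    by (simp only: poly_as_sum_of_monoms)
  also have "\<dots> = (\<Sum>i\<le>degree h. shift (- 1) (Polynomial.monom (coeff h i) i))"
    by (simp add: shift_def pcompose_sum)
  finally show ?thesis
    by (simp only: G_shift_def pow shift_monom)
qed

end

section \<open>Eigenvectors of \<open>\<delta>\<close> and a basis of \<open>K\<close> over
  \<open>F\<close>\<close>

locale artin_schreier_derivation = differential_field \<delta> for \<delta> :: "'a::field \<Rightarrow> 'a" +
  fixes p :: nat
  assumes char: "CHAR('a) = p" and p_pos: "p > 0"
    and min_poly: "is_min_poly \<delta> (Polynomial.monom 1 p - Polynomial.monom 1 1)"
begin

lemma prime_p: "prime p"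
  using prime_CHAR_semidom[where 'a = 'a] char p_pos by simp

lemma p_ge_2: "p \<ge> 2"
  using prime_p by (rule prime_ge_2_nat)

lemma of_nat_eq_0_iff: "of_nat n = (0::'a) \<longleftrightarrow> p dvd n"
  using of_nat_eq_0_iff_char_dvd[where 'a = 'a, of n] by (simp only: char)

lemma of_nat_eq_iff_below:
  assumes "i < p" "j < p"
  shows "of_nat i = (of_nat j :: 'a) \<longleftrightarrow> i = j"
proof -
  have *: "i = j" if "i \<le> j" "j < p" "of_nat i = (of_nat j :: 'a)" for i j :: nat
  proof -
    have "of_nat (j - i) = (0::'a)"
      using that by (simp add: of_nat_diff)
    then have "p dvd j - i"
      by (simp add: of_nat_eq_0_iff)
    then show ?thesis
      using that dvd_imp_le[of p "j - i"] by (cases "j = i") auto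
  qed
  show ?thesis
    using *[of i j] *[of j i] assms by (cases "i \<le> j") auto
qed

lemma frobenius_add: "(a + b :: 'a) ^ p = a ^ p + b ^ p"
  by (rule freshmans_dream) (simp_all only: char prime_p)

lemma frobenius_of_nat: "(of_nat n :: 'a) ^ p = of_nat n"
  by (induction n) (use p_pos in \<open>simp_all add: power_0_left frobenius_add\<close>)

lemma degree_artin_schreier:
  "degree (Polynomial.monom 1 p - Polynomial.monom 1 1 :: 'a poly) = p"
  using p_ge_2 by (subst diff_conv_add_uminus, subst degree_add_eq_left)
    (simp_all add: degree_monom_eq)

text \<open>Both sides vanish on the \<open>p\<close> elements of the prime field; since the
  coefficients at \<open>p\<close> agree, \<open>p\<close> points are enough.\<close>

lemma artin_schreier_factorization:
  "Polynomial.monom 1 p - Polynomial.monom 1 1 = (\<Prod>j<p. [:- of_nat j, 1 :: 'a:])"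
proof (rule poly_eqI_degree_lead_coeff[where n = p and A = "of_nat ` {..<p}"])
  have dprod: "degree (\<Prod>j<p. [:- of_nat j, 1 :: 'a:]) = p"
    by (subst degree_prod_eq_sum_degree) simp_all
  have "lead_coeff (\<Prod>j<p. [:- of_nat j, 1 :: 'a:]) = 1"
    by (simp add: lead_coeff_prod)
  then show "coeff (Polynomial.monom 1 p - Polynomial.monom 1 1) p
      = coeff (\<Prod>j<p. [:- of_nat j, 1 :: 'a:]) p"
    unfolding dprod using p_ge_2 by simp
  show "degree (\<Prod>j<p. [:- of_nat j, 1 :: 'a:]) \<le> p"
    by (simp only: dprod)
  show "degree (Polynomial.monom 1 p - Polynomial.monom 1 1 :: 'a poly) \<le> p"
    by (simp only: degree_artin_schreier)
  have "inj_on (of_nat :: nat \<Rightarrow> 'a) {..<p}"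
    by (auto simp: inj_on_def of_nat_eq_iff_below)
  then show "p \<le> card (of_nat ` {..<p} :: 'a set)"
    by (simp add: card_image)
next
  fix z :: 'a assume "z \<in> of_nat ` {..<p}"
  then obtain j where "j < p" "z = of_nat j" by blast
  moreover from this have "poly (\<Prod>j<p. [:- of_nat j, 1 :: 'a:]) z = 0"
    by (auto simp: poly_prod)
  ultimately show "poly (Polynomial.monom 1 p - Polynomial.monom 1 1) z
      = poly (\<Prod>j<p. [:- of_nat j, 1 :: 'a:]) z"
    by (simp add: poly_monom frobenius_of_nat)
qed

lemma poly_at_map_prod: "poly_at_map (\<Prod>j<p. [:- of_nat j, 1:]) \<delta> z = 0"
  using min_poly unfolding is_min_poly_def artin_schreier_factorization by blast

lemma poly_at_map_prod_Suc:
  "poly_at_map (\<Prod>j<Suc n. [:- of_nat j, 1:]) \<delta> z =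
     poly_at_map (\<Prod>j<n. [:- of_nat j, 1:]) \<delta> (\<delta> z - of_nat n * z)"
  unfolding prod.lessThan_Suc mult.commute[of _ "[:- of_nat n, 1:]"]
  by (rule poly_at_map_linear_factor) simp

lemma ex_deriv_nonzero: "\<exists>a. \<delta> a \<noteq> 0"
proof (rule ccontr)
  assume *: "\<nexists>a. \<delta> a \<noteq> 0"
  have "poly_at_map [:0, 1:] \<delta> z = 0" for z
    using * by (simp add: poly_at_map_def)
  moreover have "coeff [:0, 1:] i \<in> carrier (const_field \<delta>)" for i
    using * by (simp add: const_field_def)
  ultimately have "p \<le> degree [:0, 1 :: 'a:]"
    using min_poly degree_artin_schreier unfolding is_min_poly_def
    by (metis one_neq_zero pCons_eq_0_iff)
  then show False
    using p_ge_2 by simp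
qed

text \<open>Without an eigenvalue \<open>n\<close> with \<open>0 < n < p\<close>, the factors
  \<open>\<delta> - n\<close> could be cancelled from the zero operator
  \<open>\<delta>^p - \<delta>\<close>, leaving \<open>\<delta> = 0\<close>. Given such an
  \<open>n\<close>, a suitable power of its eigenvector has eigenvalue 1.\<close>

lemma ex_eigenvector: "\<exists>x. x \<noteq> 0 \<and> \<delta> x = x"
proof -
  have "\<exists>y n. y \<noteq> 0 \<and> 0 < n \<and> n < p \<and> \<delta> y = of_nat n * y"
  proof (rule ccontr)
    assume none: "\<nexists>y n. y \<noteq> 0 \<and> 0 < n \<and> n < p \<and> \<delta> y = of_nat n * y"
    have "\<delta> z = 0" if "Suc n \<le> p" "poly_at_map (\<Prod>j<Suc n. [:- of_nat j, 1:]) \<delta> z = 0" for n z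
      using that
    proof (induction n arbitrary: z)
      case 0
      then show ?case
        unfolding poly_at_map_prod_Suc by (simp add: poly_at_map_def)
    next
      case (Suc n)
      then have "\<delta> (\<delta> z - of_nat (Suc n) * z) = 0"
        unfolding poly_at_map_prod_Suc[of "Suc n"] by simp
      \<comment> \<open>Unless it is zero, \<open>\<delta> z\<close> is an eigenvector excluded by
        \<open>none\<close>.\<close>
      then have "\<delta> (\<delta> z) = of_nat (Suc n) * \<delta> z"
        by (simp add: deriv_diff deriv_mult deriv_add algebra_simps del: of_nat_Suc)
      then show ?case
        using none Suc.prems(1) by (metis Suc_le_lessD zero_less_Suc)
    qed
    from this[of "p - 1"] have "\<delta> z = 0" for z
      using p_pos poly_at_map_prod by simp
    then show False
      using ex_deriv_nonzero by blast
  qed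
  then obtain y n where y: "y \<noteq> 0" "0 < n" "n < p" "\<delta> y = of_nat n * y"
    by blast
  have n0: "of_nat n \<noteq> (0::'a)"
    using y by (auto simp: of_nat_eq_0_iff dest: dvd_imp_le)
  \<comment> \<open>By Fermat, \<open>n ^ (p - 2)\<close> inverts \<open>n\<close> in the prime
    field; used as exponent of \<open>y\<close>, it turns the eigenvalue \<open>n\<close> into
    1.\<close>
  have "Suc (Suc (p - 2)) = p"
    using p_ge_2 by simp
  then have "of_nat n * (of_nat n * of_nat n ^ (p - 2)) = (of_nat n :: 'a) * 1"
    using frobenius_of_nat[of n] by (metis power_Suc mult_1_right)
  then have "of_nat n * of_nat n ^ (p - 2) = (1::'a)"
    using n0 mult_left_cancel by blast
  then have "\<delta> (y ^ (n ^ (p - 2))) = y ^ (n ^ (p - 2))"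
    using deriv_power_eigenvector[OF y(4), of "n ^ (p - 2)"] by (simp add: mult.commute)
  then show ?thesis
    using y(1) by (intro exI[of _ "y ^ (n ^ (p - 2))"]) simp
qed

lemma deriv_const_mult: "\<delta> c = 0 \<Longrightarrow> \<delta> (c * a) = c * \<delta> a"
  by (simp add: deriv_mult)

text \<open>By induction on \<open>n\<close>, the kernel of the product of the
  \<open>\<delta> - j\<close> with \<open>j < n\<close> is spanned over \<open>F\<close> by the
  \<open>x^j\<close> with \<open>j < n\<close>; for \<open>n = p\<close> this kernel is
  \<open>K\<close>.\<close>

lemma eigenvector_powers_span:
  assumes x: "x \<noteq> 0" "\<delta> x = x"
  obtains c where "\<And>j. \<delta> (c j) = 0" "z = (\<Sum>j<p. c j * x ^ j)"
proof -
  have dx: "\<delta> (x ^ j) = of_nat j * x ^ j" for j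
    using deriv_power_eigenvector[of x 1 j] x by simp
  have "\<exists>c. (\<forall>j. \<delta> (c j) = 0) \<and> z = (\<Sum>j<n. c j * x ^ j)"
    if "n \<le> p" "poly_at_map (\<Prod>j<n. [:- of_nat j, 1:]) \<delta> z = 0" for n z
    using that
  proof (induction n arbitrary: z)
    case 0
    then show ?case
      by (intro exI[of _ "\<lambda>_. 0"]) (simp add: poly_at_map_def)
  next
    case (Suc n)
    then obtain c where c: "\<And>j. \<delta> (c j) = 0" "\<delta> z - of_nat n * z = (\<Sum>j<n. c j * x ^ j)"
      unfolding poly_at_map_prod_Suc by (metis Suc_leD)
    \<comment> \<open>This solves \<open>(\<delta> - n) z = \<Sum> c_j x^j\<close> term by term, as
      \<open>x^j\<close> has eigenvalue \<open>j\<close>; the denominators are nonzero for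
      \<open>j < n < p\<close>.\<close>
    define e where "e j = c j / (of_nat j - of_nat n)" for j
    have e: "\<delta> (e j) = 0" if "j < n" for j
    proof -
      have "of_nat j \<noteq> (of_nat n :: 'a)"
        using that Suc.prems(1) of_nat_eq_iff_below[of j n] by simp
      then have cj: "c j = e j * (of_nat j - of_nat n)"
        by (simp add: e_def)
      have "\<delta> (c j) = \<delta> (e j) * (of_nat j - of_nat n)"
        unfolding cj by (simp add: deriv_mult deriv_diff)
      then show ?thesis
        using c(1)[of j] \<open>of_nat j \<noteq> of_nat n\<close> by simp
    qed
    define w where "w = z - (\<Sum>j<n. e j * x ^ j)"
    have "\<delta> w - of_nat n * w = (\<Sum>j<n. c j * x ^ j) - (\<Sum>j<n. (of_nat j - of_nat n) * e j * x ^ j)"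
      unfolding w_def c(2)[symmetric]
      by (simp add: deriv_diff deriv_sum deriv_const_mult e dx sum_subtractf sum_distrib_left algebra_simps)
    also have "(\<Sum>j<n. (of_nat j - of_nat n) * e j * x ^ j) = (\<Sum>j<n. c j * x ^ j)"
    proof (rule sum.cong[OF refl])
      fix j assume "j \<in> {..<n}"
      then show "(of_nat j - of_nat n) * e j * x ^ j = c j * x ^ j"
        using Suc.prems(1) of_nat_eq_iff_below[of j n] by (simp add: e_def)
    qed
    finally have dw: "\<delta> w = of_nat n * w"
      by simp
    \<comment> \<open>\<open>w\<close> and \<open>x^n\<close> satisfy the same eigenvalue equation,
      so their quotient is a constant.\<close>
    define b where "b = w / x ^ n"
    have w: "w = b * x ^ n"
      using x by (simp add: b_def)
    have "\<delta> b * x ^ n = 0"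
      using dw unfolding w by (simp add: deriv_mult dx algebra_simps)
    then have db: "\<delta> b = 0"
      using x by simp
    have "z = (\<Sum>j<n. e j * x ^ j) + b * x ^ n"
      by (simp add: w_def flip: w)
    also have "\<dots> = (\<Sum>j<Suc n. (if j < n then e j else b) * x ^ j)"
      by simp
    finally show ?case
      using e db by (intro exI[of _ "\<lambda>j. if j < n then e j else b"]) auto
  qed
  then show thesis
    using that poly_at_map_prod[of z] by blast
qed

text \<open>Applying \<open>\<delta> - n\<close> to a relation removes its term at \<open>n\<close>
  and scales each earlier term by a nonzero \<open>j - n\<close>.\<close>

lemma eigenvector_powers_independent:
  assumes x: "x \<noteq> 0" "\<delta> x = x"
    and c: "\<And>j. j < p \<Longrightarrow> \<delta> (c j) = 0" "(\<Sum>j<p. c j * x ^ j) = 0" and "j < p"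
  shows "c j = 0"
proof -
  have dx: "\<delta> (x ^ j) = of_nat j * x ^ j" for j
    using deriv_power_eigenvector[of x 1 j] x by simp
  have "\<forall>j<n. c j = 0" if "n \<le> p" "\<And>j. j < n \<Longrightarrow> \<delta> (c j) = 0" "(\<Sum>j<n. c j * x ^ j) = 0" for n c
    using that
  proof (induction n arbitrary: c)
    case (Suc n)
    have "(\<Sum>j<Suc n. of_nat j * c j * x ^ j) = \<delta> (\<Sum>j<Suc n. c j * x ^ j)"
      unfolding deriv_sum
      by (rule sum.cong[OF refl]) (simp add: deriv_const_mult Suc.prems(2) dx algebra_simps)
    also have "\<dots> = of_nat n * (\<Sum>j<Suc n. c j * x ^ j)"
      unfolding Suc.prems(3) by simp
    finally have "(\<Sum>j<n. ((of_nat j - of_nat n) * c j) * x ^ j) = 0"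
      by (simp add: sum_distrib_left sum_subtractf algebra_simps)
    then have "\<forall>j<n. (of_nat j - of_nat n) * c j = 0"
      using Suc.prems by (intro Suc.IH) (simp_all add: deriv_mult deriv_diff)
    then have "\<forall>j<n. c j = 0"
      using Suc.prems(1) of_nat_eq_iff_below[of _ n] by auto
    with Suc.prems(3) x show ?case
      by (auto simp: less_Suc_eq)
  qed simp
  with assms show ?thesis by blast
qed

subsection \<open>Right factors of \<open>t\<^sup>p - t - d\<close>\<close>

definition artin_schreier :: "'a \<Rightarrow> 'a poly" where
  "artin_schreier d = Polynomial.monom 1 p - Polynomial.monom 1 1 - [:d:]"

lemma degree_artin_schreier_poly [simp]: "degree (artin_schreier d) = p"
proof -
  have "degree (Polynomial.monom 1 p - Polynomial.monom 1 1 + - [:d:]) = p"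
    using p_pos degree_artin_schreier by (subst degree_add_eq_left) simp_all
  then show ?thesis
    by (simp only: artin_schreier_def diff_conv_add_uminus)
qed

lemma artin_schreier_nonzero [simp]: "artin_schreier d \<noteq> 0"
  using degree_artin_schreier_poly[of d] p_pos by (metis degree_0 less_irrefl)

text \<open>By additivity of Frobenius, the translation changes \<open>t^p - t\<close> by
  \<open>c^p - c = 0\<close>.\<close>

lemma shift_artin_schreier:
  assumes "c ^ p = c"
  shows "shift c (artin_schreier d) = artin_schreier d"
proof -
  have "[:c, 1:] ^ p = ([:c:] + [:0, 1:]) ^ p"
    by simp
  also have "\<dots> = [:c:] ^ p + [:0, 1:] ^ p"
    by (rule freshmans_dream) (simp_all only: semiring_char_poly char prime_p)
  also have "\<dots> = [:c:] + Polynomial.monom 1 p"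
    by (simp add: poly_const_pow assms monom_altdef)
  finally have "[:c, 1:] ^ p = [:c:] + Polynomial.monom 1 p" .
  moreover have "[:c, 1:] = [:c:] + Polynomial.monom 1 1"
    by (simp add: monom_altdef)
  ultimately show ?thesis
    by (simp add: artin_schreier_def shift_diff shift_monom)
qed

text \<open>Substitute \<open>t^p = (t - z)^p + V_p(z)\<close> and
  \<open>t = (t - z) + z\<close>.\<close>

lemma artin_schreier_division:
  "artin_schreier d =
     ([:- z, 1:] [^]\<^bsub>diff_poly_ring \<delta>\<^esub> (p - 1) - 1) \<star> [:- z, 1:] + [:Vp \<delta> p z - z - d:]"
proof -
  have "[:- z, 1:] [^]\<^bsub>diff_poly_ring \<delta>\<^esub> (p - 1) \<star> [:- z, 1:] = [:- z, 1:] [^]\<^bsub>diff_poly_ring \<delta>\<^esub> p"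
    using skew_pow_Suc2[of "[:- z, 1:]" "p - 1"] p_pos by simp
  also have "\<dots> = Polynomial.monom 1 p - [:Vp \<delta> p z:]"
    using linear_skew_pow_char[OF prime_p char, of "- z"]
    by (simp add: Vp_eq[OF prime_p char] minus_power_char[OF prime_p char] funpow_deriv_minus)
  finally show ?thesis
    by (simp add: artin_schreier_def skew_diff_left skew_mult_1_left monom_altdef)
qed

lemma linear_right_factor_iff:
  "artin_schreier d \<in> left_multiples [:- z, 1:] \<longleftrightarrow> Vp \<delta> p z - z = d"
proof -
  have "rmod \<delta> (artin_schreier d) [:- z, 1:] = [:Vp \<delta> p z - z - d:]"
    by (rule rmod_unique[OF _ artin_schreier_division]) (simp_all add: polys_below_iff)
  moreover have "rmod \<delta> (artin_schreier d) [:- z, 1:] = 0 \<longleftrightarrow> artin_schreier d \<in> left_multiples [:- z, 1:]"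
    by (rule rmod_eq_0_iff) simp
  ultimately show ?thesis
    by auto
qed

text \<open>Under ordinary evaluation \<open>j\<close> takes the same value at all \<open>p\<close>
  elements of the prime field, so below degree \<open>p\<close> it would be constant.\<close>

lemma translation_invariant_degree:
  assumes "shift 1 j = j" "degree j > 0"
  shows "p \<le> degree j"
proof (rule ccontr)
  assume "\<not> p \<le> degree j"
  have step: "poly j (a + 1) = poly j a" for a
    using arg_cong[OF assms(1), of "\<lambda>u. poly u a"] by (simp add: shift_def poly_pcompose add.commute)
  have "poly j (of_nat n) = poly j 0" for n
    by (induction n) (simp_all add: step add.commute[of 1])
  moreover have "inj_on (of_nat :: nat \<Rightarrow> 'a) {..<p}"
    by (auto simp: inj_on_def of_nat_eq_iff_below)
  ultimately have "j = [:poly j 0:]"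
    using \<open>\<not> p \<le> degree j\<close> p_pos
    by (intro poly_eqI_degree[of "of_nat ` {..<p}"]) (auto simp: card_image)
  then show False
    using assms(2) by (metis degree_pCons_0 less_irrefl)
qed

text \<open>Translation invariance of \<open>f\<close> gives \<open>f x = x f\<close>, so
  conjugation by \<open>x\<close> preserves the right factors of \<open>f\<close>.\<close>

lemma artin_schreier_skew_eigenvector:
  assumes "\<delta> x = x"
  shows "artin_schreier d \<star> [:x ^ i:] = Polynomial.smult (x ^ i) (artin_schreier d)"
proof (induction i)
  case 0
  then show ?case by (simp add: skew_1_right flip: one_pCons)
next
  case (Suc i)
  have "[:x ^ Suc i:] = [:x:] \<star> [:x ^ i:]"
    by (simp add: skew_mult_const_left)
  then have "artin_schreier d \<star> [:x ^ Suc i:] = (artin_schreier d \<star> [:x:]) \<star> [:x ^ i:]"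
    by (simp only: skew_assoc)
  also have "artin_schreier d \<star> [:x:] = Polynomial.smult x (artin_schreier d)"
    using skew_eigenvector_right[OF assms] shift_artin_schreier[of 1 d] by simp
  finally show ?case
    by (simp add: skew_mult_smult_left Suc.IH)
qed

lemma left_multiples_smult:
  "r \<in> left_multiples g \<Longrightarrow> Polynomial.smult c r \<in> left_multiples g"
  using left_multiples_skew[of r g "[:c:]"] by (simp add: skew_mult_const_left)

lemma left_multiples_const:
  assumes "h \<in> left_multiples g" "degree h \<le> degree g" "h \<noteq> 0"
  obtains c where "c \<noteq> 0" "h = Polynomial.smult c g"
proof -
  obtain q where q: "h = q \<star> g"
    using assms(1) by (auto simp: left_multiples_def)
  with assms have "degree q = 0"
    using degree_skew[of q g] by (auto simp: skew_mult_0_left)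
  then obtain c where "q = [:c:]"
    by (rule degree_eq_zeroE)
  with q assms(3) that show thesis
    by (auto simp: skew_mult_const_left)
qed

text \<open>The least degree of a nonconstant right factor is shown to divide the prime
  \<open>p\<close>; being smaller than \<open>p\<close>, it is 1.\<close>

lemma proper_right_factor_imp_linear:
  assumes r: "artin_schreier d \<in> left_multiples r" "0 < degree r" "degree r < p"
  shows "\<exists>z. Vp \<delta> p z - z = d"
proof -
  let ?f = "artin_schreier d"
  obtain h where h: "?f \<in> left_multiples h" "0 < degree h"
    and least: "\<And>g. ?f \<in> left_multiples g \<Longrightarrow> 0 < degree g \<Longrightarrow> degree h \<le> degree g"
    using ex_has_least_nat[of "\<lambda>g. ?f \<in> left_multiples g \<and> 0 < degree g" r degree] r by blast
  have h0: "h \<noteq> 0" using h(2) by auto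
  have hp: "degree h < p" using least[OF r(1,2)] r(3) by simp
  obtain x where x: "x \<noteq> 0" "\<delta> x = x"
    using ex_eigenvector by blast
  define y where "y i = inverse (x ^ i)" for i
  have y: "y i \<noteq> 0" "[:x ^ i:] \<star> [:y i:] = 1" "[:y i:] \<star> [:x ^ i:] = 1" for i
    using x(1) by (simp_all add: y_def skew_mult_const_left one_pCons)
  \<comment> \<open>Up to the unit \<open>x^i\<close> on the left, this is the conjugate of
    \<open>h\<close> by \<open>x^i\<close>.\<close>
  define hc where "hc i = h \<star> [:y i:]" for i
  have hc0: "hc i \<noteq> 0" and deg_hc: "degree (hc i) = degree h" for i
    using h0 y(1)[of i] by (simp_all add: hc_def degree_skew)
  have f_hc: "?f \<in> left_multiples (hc i)" for i
  proof -
    have "?f = (?f \<star> [:x ^ i:]) \<star> [:y i:]"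
      by (simp only: skew_assoc y skew_1_right)
    also have "\<dots> = Polynomial.smult (x ^ i) (?f \<star> [:y i:])"
      by (simp only: artin_schreier_skew_eigenvector[OF x(2)] skew_mult_smult_left)
    finally show ?thesis
      unfolding hc_def
      using left_multiples_smult[OF left_multiples_skew_right[OF h(1), of "[:y i:]"], of "x ^ i"]
      by metis
  qed
  have le_p: "degree g \<le> p" if "?f \<in> left_multiples g" for g
    using degree_left_multiples_ge[OF that] by simp
  \<comment> \<open>Maximising over all right factors with degree a multiple of
    \<open>degree h\<close> avoids iterated least common multiples; \<open>1\<close>, of degree 0,
    is a candidate.\<close>
  obtain l where l: "?f \<in> left_multiples l" "degree h dvd degree l"
    and greatest: "\<And>g. ?f \<in> left_multiples g \<Longrightarrow> degree h dvd degree g \<Longrightarrow> degree g \<le> degree l"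
  proof -
    have "?f \<in> left_multiples 1"
      using left_multiplesI[of ?f 1] by (simp add: skew_1_right)
    then have "?f \<in> left_multiples 1 \<and> degree h dvd degree (1 :: 'a poly)"
      by simp
    moreover have "\<forall>g. ?f \<in> left_multiples g \<and> degree h dvd degree g \<longrightarrow> degree g < Suc p"
      using le_p by (simp add: less_Suc_eq_le)
    ultimately have "\<exists>l. (?f \<in> left_multiples l \<and> degree h dvd degree l) \<and>
        (\<forall>g. ?f \<in> left_multiples g \<and> degree h dvd degree g \<longrightarrow> degree g \<le> degree l)"
      by (rule ex_has_greatest_nat)
    then show thesis using that by blast
  qed
  have l0: "l \<noteq> 0"
    using l(1) by (auto simp: left_multiples_def)
  \<comment> \<open>Otherwise \<open>l\<close> and \<open>hc i\<close> have no common right factor,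
    and their least common left multiple \<open>u \<star> l\<close> is a right factor of
    \<open>f\<close> of degree \<open>degree h + degree l\<close>, against maximality.\<close>
  have l_hc: "l \<in> left_multiples (hc i)" for i
  proof (rule ccontr)
    assume not: "l \<notin> left_multiples (hc i)"
    obtain g a b where g: "lead_coeff g = 1" "l \<in> left_multiples g" "hc i \<in> left_multiples g"
      and gab: "g = a \<star> l + b \<star> hc i"
      using bezout_left[OF l0] by metis
    \<comment> \<open>By minimality of \<open>degree h\<close>, a nonconstant common right factor
      would equal \<open>hc i\<close> up to a scalar.\<close>
    have "degree g = 0"
    proof (rule ccontr)
      assume "degree g \<noteq> 0"
      then have "degree h \<le> degree g"
        using least left_multiples_trans[OF l(1) g(2)] by simp
      then obtain c where c: "c \<noteq> 0" "hc i = Polynomial.smult c g"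
        using left_multiples_const[OF g(3)] hc0 deg_hc by metis
      then have "g = Polynomial.smult (inverse c) (hc i)"
        by simp
      then have "g \<in> left_multiples (hc i)"
        using left_multiples_smult[OF left_multiples_self] by metis
      then show False
        using not left_multiples_trans[OF g(2)] by blast
    qed
    with g(1) have "g = 1"
      by (auto elim!: degree_eq_zeroE simp: one_pCons)
    then obtain u where u: "lead_coeff u = 1" "degree u = degree h"
      and ann: "{r. r \<star> l \<in> left_multiples (hc i)} = left_multiples u"
      using annihilator_mod_coprime[OF hc0, of a l b i] gab deg_hc by metis
    obtain q where q: "?f = q \<star> l"
      using l(1) by (auto simp: left_multiples_def)
    then have "q \<in> left_multiples u"
      using f_hc ann by auto
    then have "?f \<in> left_multiples (u \<star> l)"
      unfolding q by (rule left_multiples_skew_right)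
    moreover have "degree (u \<star> l) = degree h + degree l"
      using u l0 degree_skew[of u l] by fastforce
    ultimately have "degree h + degree l \<le> degree l"
      using greatest[of "u \<star> l"] l(2) by simp
    then show False
      using h(2) by simp
  qed
  \<comment> \<open>The intersection of the left ideals of all \<open>hc i\<close>. Right
    multiplication by \<open>x\<close> only raises \<open>i\<close>, so it preserves
    \<open>?J\<close>, which will make the generator translation invariant.\<close>
  let ?J = "{r. \<forall>i. r \<star> [:x ^ i:] \<in> left_multiples h}"
  have "l \<star> [:x ^ i:] \<in> left_multiples h" for i
  proof -
    have "hc i \<star> [:x ^ i:] = h"
      by (simp only: hc_def skew_assoc y skew_1_right)
    then show ?thesis
      using left_multiples_skew_right[OF l_hc[of i], of "[:x ^ i:]"] by simp
  qed
  then have "l \<in> ?J" by simp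
  then obtain j where j: "lead_coeff j = 1" "?J = left_multiples j"
    using l0 by (rule left_ideal_principal)
      (auto simp: skew_mult_add_left left_multiples_add skew_assoc left_multiples_skew)
  have j0: "j \<noteq> 0" using j(1) by auto
  have jJ: "j \<in> ?J"
    unfolding j(2) by (rule left_multiples_self)
  have "j \<star> [:x ^ 0:] \<in> left_multiples h"
    using jJ by blast
  then have "degree h \<le> degree j"
    using degree_left_multiples_ge[of j h] j0 by (simp add: skew_1_right flip: one_pCons)
  have jx: "j \<star> [:x:] = Polynomial.smult x (shift 1 j)"
    by (rule skew_eigenvector_right[OF x(2)])
  have "j \<star> [:x:] \<star> [:x ^ i:] \<in> left_multiples h" for i
  proof -
    have "j \<star> [:x:] \<star> [:x ^ i:] = j \<star> [:x ^ Suc i:]"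
      by (simp add: skew_assoc skew_mult_const_left)
    moreover have "j \<star> [:x ^ Suc i:] \<in> left_multiples h"
      using jJ by blast
    ultimately show ?thesis by simp
  qed
  then have "j \<star> [:x:] \<in> ?J"
    by blast
  then have "j \<star> [:x:] \<in> left_multiples j"
    by (simp only: j(2))
  \<comment> \<open>A left multiple of \<open>j\<close> of the same degree is a scalar multiple;
    leading coefficients will give \<open>c = x\<close>.\<close>
  then obtain c where c: "Polynomial.smult x (shift 1 j) = Polynomial.smult c j"
  proof (rule left_multiples_const)
    show "degree (j \<star> [:x:]) \<le> degree j"
      by (simp add: jx)
    show "j \<star> [:x:] \<noteq> 0"
      using x(1) j0 by simp
  qed (use that jx in simp)
  have "lead_coeff (shift 1 j) = 1"
    using j(1) by (simp add: shift_def lead_coeff_comp)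
  then have "c = x"
    using arg_cong[OF c, of "\<lambda>u. coeff u (degree j)"] j(1) by simp
  then have "shift 1 j = j"
    using c x(1) by (metis smult_cancel)
  \<comment> \<open>Now \<open>p \<le> degree j \<le> degree l \<le> p\<close>, so
    \<open>degree h\<close> is a proper divisor of \<open>p\<close>.\<close>
  then have "p \<le> degree j"
    using translation_invariant_degree \<open>degree h \<le> degree j\<close> h(2) by simp
  moreover have "degree j \<le> degree l"
    using \<open>l \<in> ?J\<close> l0 unfolding j(2) by (rule degree_left_multiples_ge)
  ultimately have "degree l = p"
    using le_p[OF l(1)] by simp
  with l(2) have "degree h = 1"
    using hp prime_p by (auto simp: prime_nat_iff)
  then obtain a b where hab: "h = [:a, b:]" "b \<noteq> 0"
    using degree1_coeffs by blast
  have "h = [:b:] \<star> [:- (- a / b), 1:]"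
    using hab by (simp add: skew_mult_const_left)
  then have "h \<in> left_multiples [:- (- a / b), 1:]"
    by (metis left_multiplesI)
  then have "?f \<in> left_multiples [:- (- a / b), 1:]"
    using h(1) left_multiples_trans by blast
  then show ?thesis
    by (auto simp only: linear_right_factor_iff)
qed

text \<open>The greatest common right divisor of \<open>b\<close> and \<open>f\<close> has degree
  below \<open>p\<close>, hence is 1. The annihilator of \<open>b\<close> modulo \<open>f\<close> is
  then generated in degree \<open>p\<close> and contains no nonzero \<open>a\<close> of smaller
  degree.\<close>

lemma no_zero_divisors:
  assumes no_root: "\<And>z. Vp \<delta> p z - z \<noteq> d"
    and below: "a \<in> polys_below p" "b \<in> polys_below p"
    and ab: "a \<star> b \<in> left_multiples (artin_schreier d)" and b: "b \<noteq> 0"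
  shows "a = 0"
proof -
  let ?f = "artin_schreier d"
  obtain g u v where g: "lead_coeff g = 1" "b \<in> left_multiples g" "?f \<in> left_multiples g"
    and guv: "g = u \<star> b + v \<star> ?f"
    using bezout_left[OF b] by metis
  have "degree g < p"
    using degree_left_multiples_ge[OF g(2) b] below(2) b by (simp add: polys_below_iff)
  then have "degree g = 0"
    using proper_right_factor_imp_linear[OF g(3)] no_root by auto
  with g(1) have "g = 1"
    by (auto elim!: degree_eq_zeroE simp: one_pCons)
  then obtain w where w: "degree w = p" "{r. r \<star> b \<in> left_multiples ?f} = left_multiples w"
    using annihilator_mod_coprime[of ?f u b v] guv by auto
  then have "a \<in> left_multiples w"
    using ab by blast
  then show "a = 0"
    using below(1) w(1) left_multiples_below by blast
qed

lemma zero_divisors: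
  assumes "Vp \<delta> p z - z = d"
  obtains a b where "a \<in> polys_below p" "b \<in> polys_below p" "a \<noteq> 0" "b \<noteq> 0"
    "a \<star> b = artin_schreier d"
proof -
  let ?b = "[:- z, 1:]"
  obtain a where a: "artin_schreier d = a \<star> ?b"
    using linear_right_factor_iff assms by (auto simp: left_multiples_def)
  then have a0: "a \<noteq> 0"
    using artin_schreier_nonzero[of d] by (auto simp: skew_mult_0_left)
  have "degree a + 1 = p"
    using arg_cong[OF a, of degree] degree_skew[OF a0, of ?b] by simp
  then show thesis
    using that[of a ?b] a a0 p_ge_2 by (simp add: polys_below_iff)
qed

end

section \<open>Finite-dimensional algebras without zero divisors\<close>

text \<open>The image of a basis is independent with \<open>dim\<close> elements, hence again a
  basis.\<close>

lemma (in vectorspace) injective_endomorphism_bij: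
  assumes fd: "fin_dim" and T: "T \<in> module_hom K V V"
    and ker: "\<And>v. v \<in> carrier V \<Longrightarrow> T v = \<zero>\<^bsub>V\<^esub> \<Longrightarrow> v = \<zero>\<^bsub>V\<^esub>"
  shows "bij_betw T (carrier V) (carrier V)"
proof -
  interpret T: linear_map K V V T
    by (intro linear_map.intro vectorspace_axioms mod_hom.intro module_axioms mod_hom_axioms.intro T)
  have "carrier (vs T.ker) = {\<zero>\<^bsub>V\<^esub>}"
    using ker by (auto simp: T.ker_def)
  then have inj: "inj_on T (carrier V)"
    by (rule T.Ke0_imp_inj)
  obtain B where B: "finite B" "basis B"
    using finite_basis_exists[OF fd] by blast
  then have li: "lin_indpt B" and BV: "B \<subseteq> carrier V"
    by (auto simp: basis_def)
  have TV: "T ` carrier V \<subseteq> carrier V"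
    using T by (auto simp: module_hom_def)
  have TBV: "T ` B \<subseteq> carrier V"
    using BV TV by blast
  have image: "lincomb a (T ` B) = T (lincomb (a \<circ> T) B)" if "a \<in> T ` B \<rightarrow> carrier K" for a
    by (rule T.lincomb_linear_image[OF inj BV that B(1)])
  have "lin_indpt (T ` B)"
  proof (rule finite_lin_indpt2)
    fix a assume a: "a \<in> T ` B \<rightarrow> carrier K" "lincomb a (T ` B) = \<zero>\<^bsub>V\<^esub>"
    have aT: "a \<circ> T \<in> B \<rightarrow> carrier K"
      using a(1) by auto
    have "lincomb (a \<circ> T) B = \<zero>\<^bsub>V\<^esub>"
      using ker[OF lincomb_closed[OF BV aT]] image[OF a(1)] a(2) by simp
    then show "\<forall>v\<in>T ` B. a v = \<zero>\<^bsub>K\<^esub>"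
      using not_lindepD[OF li B(1) subset_refl aT] by auto
  qed (use B BV TV in auto)
  moreover have "card (T ` B) = dim"
    using card_image[OF inj_on_subset[OF inj BV]] dim_basis[OF B] by simp
  ultimately have "basis (T ` B)"
    using BV TV B(1) by (intro dim_li_is_basis[OF fd]) auto
  then have span: "span (T ` B) = carrier V"
    by (simp add: basis_def)
  have "v \<in> T ` carrier V" if v: "v \<in> carrier V" for v
  proof -
    obtain a where a: "a \<in> T ` B \<rightarrow> carrier K" "lincomb a (T ` B) = v"
      using finite_in_span[OF finite_imageI[OF B(1)] TBV v[folded span]] by blast
    have "lincomb (a \<circ> T) B \<in> carrier V"
      using a(1) by (intro lincomb_closed[OF BV]) auto
    then show ?thesis
      using image[OF a(1)] a(2) by blast
  qed
  then show ?thesis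
    using inj TV by (auto simp: bij_betw_def)
qed

text \<open>Multiplications by a nonzero element are linear with trivial kernel, so finite dimension
  makes them bijective.\<close>

lemma (in unital_nonassoc_algebra) division_algebraI:
  assumes fd: "fin_dim" and nontrivial: "\<one> \<noteq> \<zero>"
    and no_zero_div: "\<And>x y. x \<in> carrier A \<Longrightarrow> y \<in> carrier A \<Longrightarrow> x \<otimes> y = \<zero> \<Longrightarrow> x = \<zero> \<or> y = \<zero>"
  shows "division_algebra A"
  unfolding division_algebra_def
proof (intro conjI ballI)
  show "carrier A \<noteq> {\<zero>}"
    using one_in_carrier nontrivial by blast
next
  fix a assume a: "a \<in> carrier A - {\<zero>}"
  have "(\<lambda>x. a \<otimes> x) \<in> module_hom F A A"
    using a by (auto simp: module_hom_def mult_closed mult_add_right mult_smult_right)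
  then show "bij_betw (\<lambda>x. a \<otimes> x) (carrier A) (carrier A)"
    using a no_zero_div by (intro injective_endomorphism_bij[OF fd]) auto
  have "(\<lambda>x. x \<otimes> a) \<in> module_hom F A A"
    using a by (auto simp: module_hom_def mult_closed mult_add_left mult_smult_left)
  then show "bij_betw (\<lambda>x. x \<otimes> a) (carrier A) (carrier A)"
    using a no_zero_div by (intro injective_endomorphism_bij[OF fd]) auto
qed

context differential_field
begin

subsection \<open>The Petit algebra\<close>

lemma deriv_inverse_const:
  assumes "\<delta> a = 0"
  shows "\<delta> (inverse a) = 0"
proof (cases "a = 0")
  case False
  then have "\<delta> (a * inverse a) = 0" by simp
  then show ?thesis
    using assms False by (simp only: deriv_mult) simp
qed simp

lemma field_const_field: "field (const_field \<delta>)"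
proof -
  interpret cring "const_field \<delta>"
  proof (rule cringI)
    show "abelian_group (const_field \<delta>)"
    proof (rule abelian_groupI)
      fix x assume "x \<in> carrier (const_field \<delta>)"
      then show "\<exists>y\<in>carrier (const_field \<delta>). y \<oplus>\<^bsub>const_field \<delta>\<^esub> x = \<zero>\<^bsub>const_field \<delta>\<^esub>"
        by (intro bexI[of _ "- x"]) (simp_all add: const_field_def deriv_minus)
    qed (simp_all add: const_field_def deriv_add algebra_simps)
    show "comm_monoid (const_field \<delta>)"
      by (rule comm_monoidI) (simp_all add: const_field_def deriv_mult algebra_simps)
  qed (simp_all add: const_field_def algebra_simps)
  show ?thesis
  proof (rule cring_fieldI2)
    fix a assume "a \<in> carrier (const_field \<delta>)" "a \<noteq> \<zero>\<^bsub>const_field \<delta>\<^esub>"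
    then show "\<exists>b\<in>carrier (const_field \<delta>). a \<otimes>\<^bsub>const_field \<delta>\<^esub> b = \<one>\<^bsub>const_field \<delta>\<^esub>"
      by (intro bexI[of _ "inverse a"]) (simp_all add: const_field_def deriv_inverse_const)
  qed (simp add: const_field_def)
qed

text \<open>Constants commute with \<open>t\<close>; this makes multiplication in \<open>S_f\<close>
  linear over \<open>F\<close> in its second argument.\<close>

lemma skew_smult_const_right:
  assumes "\<delta> c = 0"
  shows "g \<star> Polynomial.smult c h = Polynomial.smult c (g \<star> h)"
proof -
  have "g \<star> [:c:] = g * [:c:]"
    by (rule skew_constants_right) (simp add: map_poly_deriv_pCons assms)
  then have "g \<star> [:c:] = Polynomial.smult c g"
    by simp
  then have "(g \<star> [:c:]) \<star> h = Polynomial.smult c (g \<star> h)"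
    by (simp add: skew_mult_smult_left)
  then show ?thesis
    by (simp add: skew_assoc skew_mult_const_left)
qed

lemma carrier_petit_algebra:
  "degree f > 0 \<Longrightarrow> carrier (petit_algebra \<delta> f) = polys_below (degree f)"
  by (auto simp: petit_algebra_def polys_below_iff)

lemma petit_algebra_simps [simp]:
  "h \<otimes>\<^bsub>petit_algebra \<delta> f\<^esub> k = rmod \<delta> (h \<star> k) f"
  "h \<oplus>\<^bsub>petit_algebra \<delta> f\<^esub> k = h + k"
  "c \<odot>\<^bsub>petit_algebra \<delta> f\<^esub> h = Polynomial.smult c h"
  "\<one>\<^bsub>petit_algebra \<delta> f\<^esub> = 1" "\<zero>\<^bsub>petit_algebra \<delta> f\<^esub> = 0"
  by (simp_all add: petit_algebra_def)

lemma const_field_simps [simp]: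
  "c \<in> carrier (const_field \<delta>) \<longleftrightarrow> \<delta> c = 0"
  "b \<otimes>\<^bsub>const_field \<delta>\<^esub> c = b * c" "b \<oplus>\<^bsub>const_field \<delta>\<^esub> c = b + c"
  "\<one>\<^bsub>const_field \<delta>\<^esub> = 1" "\<zero>\<^bsub>const_field \<delta>\<^esub> = 0"
  by (simp_all add: const_field_def)

text \<open>Bilinearity descends from the skew product because remainders are additive and respect
  left scalars.\<close>

lemma unital_nonassoc_algebra_petit:
  assumes f: "degree f > 0"
  shows "unital_nonassoc_algebra (const_field \<delta>) (petit_algebra \<delta> f)"
proof -
  let ?F = "const_field \<delta>" and ?S = "petit_algebra \<delta> f"
  note carrier = carrier_petit_algebra[OF f]
  have f0: "f \<noteq> 0" using f by auto
  interpret F: field ?F by (rule field_const_field)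
  have "abelian_group ?S"
  proof (rule abelian_groupI)
    fix x assume "x \<in> carrier ?S"
    then show "\<exists>y\<in>carrier ?S. y \<oplus>\<^bsub>?S\<^esub> x = \<zero>\<^bsub>?S\<^esub>"
      by (intro bexI[of _ "- x"]) (simp_all add: carrier polys_below_def)
  qed (simp_all add: carrier polys_below_def algebra_simps)
  then have "module ?F ?S"
    by (intro moduleI F.is_cring)
      (simp_all add: carrier polys_below_def smult_add_left smult_add_right)
  then have "vectorspace ?F ?S"
    by (intro vectorspace.intro field_const_field)
  moreover have "unital_nonassoc_algebra_axioms ?F ?S"
  proof
    show "x \<otimes>\<^bsub>?S\<^esub> y \<in> carrier ?S" for x y
      using rmod_cases[OF f0] by (simp add: carrier) blast
    show "\<one>\<^bsub>?S\<^esub> \<in> carrier ?S"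
      using f by (simp add: carrier polys_below_iff)
  qed (simp_all add: carrier skew_mult_add_left skew_add_right rmod_add[OF f0] skew_mult_smult_left
      rmod_smult[OF f0] skew_smult_const_right skew_mult_1_left skew_1_right rmod_below[OF f0])
  ultimately show ?thesis
    by (rule unital_nonassoc_algebra.intro)
qed

end

section \<open>Dimension of \<open>S_f\<close> and the division criterion\<close>

context artin_schreier_derivation
begin

lemma diff_algebra_eq: "diff_algebra \<delta> p d = petit_algebra \<delta> (artin_schreier d)"
  by (simp add: diff_algebra_def artin_schreier_def)

lemma carrier_diff_algebra: "carrier (diff_algebra \<delta> p d) = polys_below p"
  using carrier_petit_algebra[of "artin_schreier d"] p_pos by (simp add: diff_algebra_eq)

lemmas diff_algebra_simps [simp] = petit_algebra_simps[of "artin_schreier d" for d, folded diff_algebra_eq]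

lemma unital_nonassoc_algebra_diff_algebra:
  "unital_nonassoc_algebra (const_field \<delta>) (diff_algebra \<delta> p d)"
  unfolding diff_algebra_eq by (rule unital_nonassoc_algebra_petit) (simp add: p_pos)

text \<open>The \<open>x^j t^i\<close> with \<open>i, j < p\<close> form a basis: the
  \<open>t^i\<close> are one over \<open>K\<close>, and the \<open>x^j\<close> are one of
  \<open>K\<close> over \<open>F\<close>.\<close>

lemma dim_diff_algebra:
  "vectorspace.fin_dim (const_field \<delta>) (diff_algebra \<delta> p d)"
  "vectorspace.dim (const_field \<delta>) (diff_algebra \<delta> p d) = p ^ 2"
proof -
  let ?F = "const_field \<delta>" and ?S = "diff_algebra \<delta> p d"
  interpret S: unital_nonassoc_algebra ?F ?S
    by (rule unital_nonassoc_algebra_diff_algebra)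
  obtain x where x: "x \<noteq> 0" "\<delta> x = x"
    using ex_eigenvector by blast
  define e where "e = (\<lambda>(i::nat, j). Polynomial.monom (x ^ j) i)"
  define I where "I = {..<p} \<times> {..<p}"
  have finsum: "finsum ?S g A = sum g A" if "finite A" "g \<in> A \<rightarrow> carrier ?S" for g and A :: "'a poly set"
    using that by (induction A rule: finite_induct) auto
  \<comment> \<open>The exponent \<open>j\<close> is recovered from the eigenvalue of
    \<open>x^j\<close>.\<close>
  have "inj_on e I"
  proof (rule inj_onI, clarsimp simp: I_def e_def)
    fix i j i' j' assume *: "j < p" "j' < p" "Polynomial.monom (x ^ j) i = Polynomial.monom (x ^ j') i'"
    have "i = i'" "x ^ j = x ^ j'"
      using arg_cong[OF *(3), of degree] arg_cong[OF *(3), of lead_coeff] x(1)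
      by (simp_all add: degree_monom_eq)
    moreover from this have "of_nat j * x ^ j = of_nat j' * x ^ j"
      using deriv_power_eigenvector[of x 1 j] deriv_power_eigenvector[of x 1 j'] x by simp
    then have "of_nat j = (of_nat j' :: 'a)"
      using x(1) by simp
    ultimately show "i = i' \<and> j = j'"
      using * of_nat_eq_iff_below by blast
  qed
  have eI: "e ` I \<subseteq> carrier ?S" "finite (e ` I)"
    by (auto simp: carrier_diff_algebra polys_below_def e_def I_def)
  \<comment> \<open>Each coefficient is a combination of powers of \<open>x\<close>, which reduces
    independence and spanning to the same facts in \<open>K\<close>.\<close>
  have coeff_lincomb: "coeff (S.lincomb a (e ` I)) i = (\<Sum>j<p. a (e (i, j)) * x ^ j)"
    if "a \<in> e ` I \<rightarrow> carrier ?F" "i < p" for a i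
  proof -
    have "(\<lambda>v. Polynomial.smult (a v) v) \<in> e ` I \<rightarrow> carrier ?S"
      using eI(1) by (auto simp: carrier_diff_algebra polys_below_def)
    then have "S.lincomb a (e ` I) = (\<Sum>v\<in>e ` I. Polynomial.smult (a v) v)"
      using finsum[OF eI(2)] by (simp add: S.lincomb_def)
    also have "\<dots> = (\<Sum>(k, j)\<in>I. Polynomial.smult (a (e (k, j))) (Polynomial.monom (x ^ j) k))"
      unfolding sum.reindex[OF \<open>inj_on e I\<close>] by (rule sum.cong[OF refl]) (auto simp: e_def)
    also have "coeff \<dots> i = (\<Sum>(k, j)\<in>I. if k = i then a (e (k, j)) * x ^ j else 0)"
      unfolding coeff_sum by (rule sum.cong[OF refl]) auto
    also have "\<dots> = (\<Sum>k<p. \<Sum>j<p. if k = i then a (e (k, j)) * x ^ j else 0)"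
      by (simp only: I_def sum.cartesian_product)
    also have "\<dots> = (\<Sum>k<p. if k = i then (\<Sum>j<p. a (e (k, j)) * x ^ j) else 0)"
      by (rule sum.cong) auto
    also have "\<dots> = (\<Sum>j<p. a (e (i, j)) * x ^ j)"
      using that(2) by simp
    finally show ?thesis .
  qed
  have lin: "S.lin_indpt (e ` I)"
  proof (rule S.finite_lin_indpt2[OF eI(2,1)])
    fix a assume a: "a \<in> e ` I \<rightarrow> carrier ?F" and "S.lincomb a (e ` I) = \<zero>\<^bsub>?S\<^esub>"
    then have sum0: "(\<Sum>j<p. a (e (i, j)) * x ^ j) = 0" if "i < p" for i
      using coeff_lincomb[OF a that] by simp
    have "a (e (i, j)) = 0" if "i < p" "j < p" for i j
    proof (rule eigenvector_powers_independent[OF x _ sum0[OF that(1)] that(2)])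
      fix j assume "j < p"
      then have "e (i, j) \<in> e ` I"
        using that by (auto simp: I_def)
      then show "\<delta> (a (e (i, j))) = 0"
        using a by auto
    qed
    then show "\<forall>v\<in>e ` I. a v = \<zero>\<^bsub>?F\<^esub>"
      by (auto simp: I_def)
  qed
  have gen: "S.span (e ` I) = carrier ?S"
  proof
    show "S.span (e ` I) \<subseteq> carrier ?S"
      using S.span_closed[OF eI(1)] by blast
    show "carrier ?S \<subseteq> S.span (e ` I)"
    proof
      fix u assume u: "u \<in> carrier ?S"
      have "\<exists>c. (\<forall>j. \<delta> (c j) = 0) \<and> coeff u i = (\<Sum>j<p. c j * x ^ j)" for i
        using eigenvector_powers_span[OF x, of "coeff u i"] by metis
      then obtain c where c: "\<And>i j. \<delta> (c i j) = 0" "\<And>i. coeff u i = (\<Sum>j<p. c i j * x ^ j)"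
        by metis
      \<comment> \<open>Scalars in \<open>lincomb\<close> are indexed by vectors, hence the inverse
        of \<open>e\<close>.\<close>
      define a where "a v = (case inv_into I e v of (i, j) \<Rightarrow> c i j)" for v
      have a: "a \<in> e ` I \<rightarrow> carrier ?F"
        by (auto simp: a_def c split: prod.splits)
      have ae: "a (e (i, j)) = c i j" if "i < p" "j < p" for i j
        using inv_into_f_f[OF \<open>inj_on e I\<close>, of "(i, j)"] that by (simp add: a_def I_def)
      have "S.lincomb a (e ` I) \<in> carrier ?S"
        by (rule S.lincomb_closed[OF eI(1) a])
      then have "coeff u i = coeff (S.lincomb a (e ` I)) i" for i
        using u coeff_lincomb[OF a, of i] ae c(2)[of i]
        by (cases "i < p") (simp_all add: carrier_diff_algebra polys_below_def)
      then have "u = S.lincomb a (e ` I)"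
        by (rule poly_eqI)
      then show "u \<in> S.span (e ` I)"
        using a eI(2) by (auto simp: S.span_def)
    qed
  qed
  show "S.fin_dim"
    using eI gen by (auto simp: S.fin_dim_def)
  have "S.basis (e ` I)"
    using lin gen eI by (simp add: S.basis_def)
  then show "S.dim = p ^ 2"
    using S.dim_basis[OF eI(2)] card_image[OF \<open>inj_on e I\<close>]
    by (simp add: I_def power2_eq_square)
qed

lemma division_algebra_iff:
  "division_algebra (diff_algebra \<delta> p d) \<longleftrightarrow> (\<forall>z. Vp \<delta> p z - z \<noteq> d)"
proof
  let ?S = "diff_algebra \<delta> p d"
  assume div: "division_algebra ?S"
  show "\<forall>z. Vp \<delta> p z - z \<noteq> d"
  proof (intro allI notI)
    fix z assume "Vp \<delta> p z - z = d"
    then obtain a b where ab: "a \<in> carrier ?S" "b \<in> carrier ?S" "a \<noteq> 0" "b \<noteq> 0"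
        "a \<star> b = artin_schreier d"
      using zero_divisors unfolding carrier_diff_algebra by blast
    then have "bij_betw (\<lambda>x. a \<otimes>\<^bsub>?S\<^esub> x) (carrier ?S) (carrier ?S)"
      using div by (auto simp: division_algebra_def)
    then have inj: "inj_on (\<lambda>x. a \<otimes>\<^bsub>?S\<^esub> x) (carrier ?S)"
      by (rule bij_betw_imp_inj_on)
    \<comment> \<open>The skew product of \<open>a\<close> and \<open>b\<close> is \<open>f\<close>,
      which has remainder zero.\<close>
    have "a \<otimes>\<^bsub>?S\<^esub> b = 0" "a \<otimes>\<^bsub>?S\<^esub> 0 = 0"
      using ab(5) left_multiples_self[of "artin_schreier d"] left_multiplesI[of 0 "artin_schreier d"]
      by (simp_all add: rmod_eq_0_iff skew_mult_0_left)
    moreover have "0 \<in> carrier ?S"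
      by (simp add: carrier_diff_algebra polys_below_iff)
    ultimately have "b = 0"
      using inj ab(2) by (metis inj_onD)
    with ab(4) show False by simp
  qed
next
  let ?S = "diff_algebra \<delta> p d"
  assume "\<forall>z. Vp \<delta> p z - z \<noteq> d"
  then have nzd: "a = 0"
    if "a \<in> polys_below p" "b \<in> polys_below p" "a \<star> b \<in> left_multiples (artin_schreier d)" "b \<noteq> 0" for a b
    using no_zero_divisors that by blast
  show "division_algebra ?S"
  proof (rule unital_nonassoc_algebra.division_algebraI[OF unital_nonassoc_algebra_diff_algebra])
    fix x y assume "x \<in> carrier ?S" "y \<in> carrier ?S" "x \<otimes>\<^bsub>?S\<^esub> y = \<zero>\<^bsub>?S\<^esub>"
    then show "x = \<zero>\<^bsub>?S\<^esub> \<or> y = \<zero>\<^bsub>?S\<^esub>"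
      unfolding carrier_diff_algebra using nzd[of x y]
      by (auto simp: rmod_eq_0_iff)
  qed (simp_all add: dim_diff_algebra)
qed

subsection \<open>Automorphisms\<close>

lemma shift_below: "u \<in> polys_below n \<Longrightarrow> shift c u \<in> polys_below n"
  by (auto simp: polys_below_iff)

text \<open>The translation fixes \<open>f\<close> and preserves degrees, so it carries right
  divisions by \<open>f\<close> to right divisions by \<open>f\<close>.\<close>

lemma rmod_shift:
  assumes "\<delta> c = 0" "c ^ p = c"
  shows "rmod \<delta> (shift c h) (artin_schreier d) = shift c (rmod \<delta> h (artin_schreier d))"
proof -
  let ?f = "artin_schreier d"
  obtain q where "h = q \<star> ?f + rmod \<delta> h ?f" "rmod \<delta> h ?f \<in> polys_below (degree ?f)"
    using rmod_cases[OF artin_schreier_nonzero] by metis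
  then have "shift c h = shift c q \<star> ?f + shift c (rmod \<delta> h ?f)"
    by (metis shift_add shift_skew[OF assms(1)] shift_artin_schreier[OF assms(2)])
  then show ?thesis
    using \<open>rmod \<delta> h ?f \<in> polys_below (degree ?f)\<close>
    by (intro rmod_unique[of _ _ "shift c q"] shift_below) auto
qed

lemma shift_alg_auto:
  assumes c: "\<delta> c = 0" "c ^ p = c"
  shows "restrict (shift c) (carrier (diff_algebra \<delta> p d)) \<in>
    alg_auto (const_field \<delta>) (diff_algebra \<delta> p d)"
proof -
  let ?F = "const_field \<delta>" and ?S = "diff_algebra \<delta> p d"
  interpret S: unital_nonassoc_algebra ?F ?S
    by (rule unital_nonassoc_algebra_diff_algebra)
  have closed: "shift b u \<in> carrier ?S" if "u \<in> carrier ?S" for b u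
    using that by (simp add: carrier_diff_algebra shift_below)
  have "bij_betw (shift c) (carrier ?S) (carrier ?S)"
    by (rule bij_betwI[where g = "shift (- c)"])
      (auto simp: closed shift_shift shift_by_0)
  moreover have "shift c (u \<otimes>\<^bsub>?S\<^esub> v) = shift c u \<otimes>\<^bsub>?S\<^esub> shift c v" for u v
    by (simp add: shift_skew[OF c(1)] flip: rmod_shift[OF c])
  moreover have "shift c (u \<oplus>\<^bsub>?S\<^esub> v) = shift c u \<oplus>\<^bsub>?S\<^esub> shift c v" for u v
    by (simp add: shift_add)
  moreover have "shift c (a \<odot>\<^bsub>?S\<^esub> u) = a \<odot>\<^bsub>?S\<^esub> shift c u" for a u
    by (simp add: shift_smult)
  moreover have "u + v \<in> carrier ?S" "Polynomial.smult a u \<in> carrier ?S"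
    if "u \<in> carrier ?S" "v \<in> carrier ?S" for a u v
    using that by (auto simp: carrier_diff_algebra polys_below_def)
  ultimately show ?thesis
    using closed S.mult_closed
    by (auto simp: alg_auto_def module_hom_def hom_def Bij_def)
qed

lemma G_ind_eq: "G_ind \<delta> p d = restrict (shift (- 1)) (carrier (diff_algebra \<delta> p d))"
  unfolding G_ind_def by (rule restrict_ext) (rule G_shift_eq)

lemma G_ind_in_Aut: "G_ind \<delta> p d \<in> carrier (alg_AutGroup (const_field \<delta>) (diff_algebra \<delta> p d))"
proof -
  have "(- 1 :: 'a) ^ p = - 1"
    using minus_power_char[OF prime_p char, of 1] by simp
  then show ?thesis
    unfolding G_ind_eq alg_AutGroup_def by (simp add: shift_alg_auto deriv_minus)
qed

lemma G_ind_pow: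
  "G_ind \<delta> p d [^]\<^bsub>alg_AutGroup (const_field \<delta>) (diff_algebra \<delta> p d)\<^esub> n =
     restrict (shift (- of_nat n)) (carrier (diff_algebra \<delta> p d))"
proof (induction n)
  case 0
  then show ?case
    by (simp add: alg_AutGroup_def BijGroup_def shift_by_0 restrict_def)
next
  case (Suc n)
  let ?S = "diff_algebra \<delta> p d"
  let ?A = "alg_AutGroup (const_field \<delta>) ?S"
  interpret A: group ?A
    by (rule unital_nonassoc_algebra.group_alg_AutGroup[OF unital_nonassoc_algebra_diff_algebra])
  have mult: "g \<otimes>\<^bsub>?A\<^esub> h = compose (carrier ?S) g h" if "g \<in> carrier ?A" "h \<in> carrier ?A" for g h
    using that by (simp add: alg_AutGroup_def alg_auto_def BijGroup_def)
  have "G_ind \<delta> p d [^]\<^bsub>?A\<^esub> Suc n = compose (carrier ?S) (G_ind \<delta> p d [^]\<^bsub>?A\<^esub> n) (G_ind \<delta> p d)"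
    using mult[OF A.nat_pow_closed[OF G_ind_in_Aut] G_ind_in_Aut] by simp
  also have "\<dots> = restrict (shift (- of_nat (Suc n))) (carrier ?S)"
    unfolding Suc.IH unfolding G_ind_eq compose_def
    by (rule restrict_ext)
      (simp add: shift_shift carrier_diff_algebra shift_below algebra_simps)
  finally show ?case .
qed

text \<open>The \<open>n\<close>-th power sends \<open>t\<close> to \<open>t - n\<close>, so it is
  the identity exactly if \<open>n\<close> vanishes in \<open>K\<close>.\<close>

lemma ord_G_ind:
  "group.ord (alg_AutGroup (const_field \<delta>) (diff_algebra \<delta> p d)) (G_ind \<delta> p d) = p"
proof -
  let ?S = "diff_algebra \<delta> p d"
  let ?A = "alg_AutGroup (const_field \<delta>) ?S"
  interpret A: group ?A
    by (rule unital_nonassoc_algebra.group_alg_AutGroup[OF unital_nonassoc_algebra_diff_algebra])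
  have "G_ind \<delta> p d [^]\<^bsub>?A\<^esub> n = \<one>\<^bsub>?A\<^esub> \<longleftrightarrow> p dvd n" for n :: nat
  proof -
    have one: "\<one>\<^bsub>?A\<^esub> = (\<lambda>u\<in>carrier ?S. u)"
      by (simp add: alg_AutGroup_def BijGroup_def)
    have t: "[:0, 1:] \<in> carrier ?S"
      using p_ge_2 by (simp add: carrier_diff_algebra polys_below_iff)
    have "restrict (shift (- of_nat n)) (carrier ?S) = (\<lambda>u\<in>carrier ?S. u) \<longleftrightarrow> of_nat n = (0::'a)"
    proof
      assume "restrict (shift (- of_nat n)) (carrier ?S) = (\<lambda>u\<in>carrier ?S. u)"
      from fun_cong[OF this, of "[:0, 1:]"] t show "of_nat n = (0::'a)"
        by (simp add: shift_pCons)
    qed (simp add: shift_by_0 fun_eq_iff)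
    then show ?thesis
      by (simp only: G_ind_pow one of_nat_eq_0_iff)
  qed
  then show ?thesis
    using A.ord_unique[OF G_ind_in_Aut] by blast
qed

lemma G_ind_const: "G_ind \<delta> p d [:a:] = [:a:]"
  using p_pos by (simp add: G_ind_eq carrier_diff_algebra polys_below_iff)

end

theorem theorem13:
  fixes \<delta> :: "'a::field \<Rightarrow> 'a" and p :: nat and d :: 'a
  assumes "CHAR('a) = p" and "p > 0"
    and "derivation \<delta>"
    and "is_min_poly \<delta> (Polynomial.monom 1 p - Polynomial.monom 1 1)"
  shows "let F = const_field \<delta>;
             S = diff_algebra \<delta> p d;
             Aut = alg_AutGroup F S;
             G = G_ind \<delta> p d
         in unital_nonassoc_algebra F S \<and>
            vectorspace.fin_dim F S \<and> vectorspace.dim F S = p ^ 2 \<and>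
            (division_algebra S \<longleftrightarrow> (\<forall>z. Vp \<delta> p z - z \<noteq> d)) \<and>
            ((\<forall>z. Vp \<delta> p z - z \<noteq> d) \<longleftrightarrow> (\<forall>z. z ^ p + (\<delta> ^^ (p - 1)) z - z \<noteq> d)) \<and>
            G \<in> carrier Aut \<and>
            subgroup (carrier (subgroup_generated Aut {G})) Aut \<and>
            cyclic_group (subgroup_generated Aut {G}) \<and>
            order (subgroup_generated Aut {G}) = p \<and>
            (\<forall>a. G [:a:] = [:a:])"
proof -
  interpret artin_schreier_derivation \<delta> p
    using assms by unfold_locales
  let ?F = "const_field \<delta>" and ?S = "diff_algebra \<delta> p d"
  interpret A: group "alg_AutGroup ?F ?S"
    by (rule unital_nonassoc_algebra.group_alg_AutGroup[OF unital_nonassoc_algebra_diff_algebra])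
  show ?thesis
    unfolding Let_def
    using A.cyclic_order_is_ord[OF G_ind_in_Aut]
    by (intro conjI allI unital_nonassoc_algebra_diff_algebra dim_diff_algebra division_algebra_iff
        G_ind_in_Aut A.subgroup_subgroup_generated A.cyclic_group_generated G_ind_const)
      (simp_all add: Vp_eq[OF prime_p char] ord_G_ind)
qed

end
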